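(* Let $A$ be an infinite dimensional simple unital C*-algebra, and let $B \subset A$ be a stably large subalgebra. Then $A$ is stably finite if and only if $B$ is stably finite.
   Context: Subalgebras are C*-subalgebras; a unital subalgebra of $A$ contains the identity of $A$. For a C*-algebra $D$ and $a, b \in D_{+}$ (positive elements), $a \precsim_D b$ (Cuntz subequivalence) means there is a sequence $(v_n)$ in $D$ with $\lim_{n \to \infty} v_n b v_n^* = a$. Large subalgebra: let $A$ be an infinite dimensional simple unital C*-algebra. A unital subalgebra $B \subset A$ is large in $A$ if for every integer $m \geq 1$, $a_1, \ldots, a_m \in A$, $\varepsilon > 0$, $x \in A_{+}$ with $\|x\| = 1$, and $y \in B_{+} \setminus \{0\}$, there are $c_1, \ldots, c_m \in A$ and $g \in B$ such that: (1) $0 \leq g \leq 1$; (2) $\|c_j - a_j\| < \varepsilon$ for $j = 1, \ldots, m$; (3) $(1-g) c_j \in B$ for $j = 1, \ldots, m$; (4) $g \precsim_B y$ and $g \precsim_A x$; (5) $\|(1-g) x (1-g)\| > 1 - \varepsilon$. $B$ is stably large in $A$ if $M_n(B)$ is large in $M_n(A)$ for all integers $n \geq 1$. A unital C*-algebra $A$ is finite if $s^* s = 1$ implies $s s^* = 1$, and stably finite if $M_n(A)$ is finite for all $n \geq 1$. *)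

theory Defs
  imports
    "HOL-Analysis.Analysis"
    "HOL-Library.Groups_Big_Fun"
    "HOL-Library.Nonpos_Ints"
begin

section \<open>Complex star-algebras and unital C*-algebras\<close>

class complex_star_algebra = ring +
  fixes scaleC :: "complex \<Rightarrow> 'a \<Rightarrow> 'a"  (infixr \<open>*\<^sub>C\<close> 75)
    and star :: "'a \<Rightarrow> 'a"
  assumes scaleC_add_right: "c *\<^sub>C (x + y) = c *\<^sub>C x + c *\<^sub>C y"
    and scaleC_add_left: "(c + d) *\<^sub>C x = c *\<^sub>C x + d *\<^sub>C x"
    and scaleC_scaleC: "c *\<^sub>C d *\<^sub>C x = (c * d) *\<^sub>C x"
    and scaleC_one: "1 *\<^sub>C x = x"
    and mult_scaleC_left: "(c *\<^sub>C x) * y = c *\<^sub>C (x * y)"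
    and mult_scaleC_right: "x * (c *\<^sub>C y) = c *\<^sub>C (x * y)"
    and star_add: "star (x + y) = star x + star y"
    and star_scaleC: "star (c *\<^sub>C x) = cnj c *\<^sub>C star x"
    and star_mult: "star (x * y) = star y * star x"
    and star_star: "star (star x) = x"

lemma scaleC_zero_right [simp]: "c *\<^sub>C (0 :: 'a::complex_star_algebra) = 0"
  using scaleC_add_right[of c "0 :: 'a" 0] by simp

lemma star_zero [simp]: "star (0 :: 'a::complex_star_algebra) = 0"
  using star_add[of "0 :: 'a" 0] by simp

text \<open>
  \<open>cstar_norm\<close> is a separate constant because \<^const>\<open>norm\<close> is usable only on types that
  have been shown to be real normed spaces. No law is imposed on it here: the class only
  serves to state definitions. On unital C*-algebras it is \<^const>\<open>norm\<close>.
\<close>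

class star_algebra_with_norm = complex_star_algebra +
  fixes cstar_norm :: "'a \<Rightarrow> real"

class unital_cstar_algebra = star_algebra_with_norm + real_normed_algebra_1 + banach +
  assumes cstar_norm_eq: "cstar_norm x = norm x"
    and scaleR_scaleC: "r *\<^sub>R x = complex_of_real r *\<^sub>C x"
    and norm_scaleC: "norm (c *\<^sub>C x) = cmod c * norm x"
    and cstar_identity: "norm (star x * x) = (norm x)\<^sup>2"


section \<open>Matrices\<close>

text \<open>
  The algebras \<open>M\<^sub>n(A)\<close> for all \<open>n\<close> are realised in one type, the star-algebra of infinite
  matrices with finitely many nonzero entries: \<open>M\<^sub>n(A)\<close> consists of the matrices supported
  on the indices below \<open>n\<close>, and its unit is not a unit of the whole type.
\<close>

typedef (overloaded) 'a fsmat =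
  "{f :: nat \<Rightarrow> nat \<Rightarrow> 'a::zero. finite {(i, j). f i j \<noteq> 0}}"
  morphisms entry Abs_fsmat
  by (rule exI[of _ "\<lambda>_ _. 0"]) simp

setup_lifting type_definition_fsmat

lemma finite_support_iff:
  "finite {(i, j). f i j \<noteq> (0 :: 'a::zero)} \<longleftrightarrow> (\<exists>n::nat. \<forall>i j. f i j \<noteq> 0 \<longrightarrow> i < n \<and> j < n)"
proof
  assume "finite {(i, j). f i j \<noteq> 0}"
  then have "finite (fst ` {(i, j). f i j \<noteq> 0} \<union> snd ` {(i, j). f i j \<noteq> 0})" by simp
  then obtain n where n: "\<forall>k \<in> fst ` {(i, j). f i j \<noteq> 0} \<union> snd ` {(i, j). f i j \<noteq> 0}. k < n"
    using finite_nat_set_iff_bounded by blast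
  have "i < n \<and> j < n" if "f i j \<noteq> 0" for i j
  proof -
    have "(i, j) \<in> {(i, j). f i j \<noteq> 0}" using that by simp
    then show ?thesis using n by (metis Un_iff fst_conv image_eqI snd_conv)
  qed
  then show "\<exists>n::nat. \<forall>i j. f i j \<noteq> 0 \<longrightarrow> i < n \<and> j < n" by blast
next
  assume "\<exists>n::nat. \<forall>i j. f i j \<noteq> 0 \<longrightarrow> i < n \<and> j < n"
  then obtain n :: nat where n: "\<forall>i j. f i j \<noteq> 0 \<longrightarrow> i < n \<and> j < n" by blast
  have "{(i, j). f i j \<noteq> 0} \<subseteq> {..<n} \<times> {..<n}" using n by auto
  then show "finite {(i, j). f i j \<noteq> 0}"
    by (rule finite_subset) simp
qed

lemma entry_bound: "\<exists>n. \<forall>i j. n \<le> i \<or> n \<le> j \<longrightarrow> entry M i j = 0"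
  using entry[of M] unfolding mem_Collect_eq finite_support_iff by (meson not_le)

lemma fsmat_eqI: "(\<And>i j. entry M i j = entry N i j) \<Longrightarrow> M = N"
  by (simp add: entry_inject[symmetric] fun_eq_iff)

lemma Sum_any_lessThan:
  fixes n :: nat and f :: "nat \<Rightarrow> 'a::comm_monoid_add"
  assumes "\<And>k. n \<le> k \<Longrightarrow> f k = 0"
  shows "Sum_any f = sum f {..<n}"
proof (rule Sum_any.expand_superset)
  show "{k. f k \<noteq> 0} \<subseteq> {..<n}" using assms by (force simp: not_le[symmetric])
qed simp

instantiation fsmat :: (ring) ring
begin

lift_definition zero_fsmat :: "'a fsmat" is "\<lambda>_ _. 0" by simp

lift_definition plus_fsmat :: "'a fsmat \<Rightarrow> 'a fsmat \<Rightarrow> 'a fsmat"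
  is "\<lambda>f g i j. f i j + g i j"
proof -
  fix f g :: "nat \<Rightarrow> nat \<Rightarrow> 'a"
  assume "finite {(i, j). f i j \<noteq> 0}" "finite {(i, j). g i j \<noteq> 0}"
  then show "finite {(i, j). f i j + g i j \<noteq> 0}"
    by (rule finite_subset[rotated, OF finite_UnI]) auto
qed

lift_definition uminus_fsmat :: "'a fsmat \<Rightarrow> 'a fsmat" is "\<lambda>f i j. - f i j" by simp

lift_definition minus_fsmat :: "'a fsmat \<Rightarrow> 'a fsmat \<Rightarrow> 'a fsmat"
  is "\<lambda>f g i j. f i j - g i j"
proof -
  fix f g :: "nat \<Rightarrow> nat \<Rightarrow> 'a"
  assume "finite {(i, j). f i j \<noteq> 0}" "finite {(i, j). g i j \<noteq> 0}"
  then show "finite {(i, j). f i j - g i j \<noteq> 0}"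
    by (rule finite_subset[rotated, OF finite_UnI]) auto
qed

lift_definition times_fsmat :: "'a fsmat \<Rightarrow> 'a fsmat \<Rightarrow> 'a fsmat"
  is "\<lambda>f g i j. Sum_any (\<lambda>k. f i k * g k j)"
proof -
  fix f g :: "nat \<Rightarrow> nat \<Rightarrow> 'a"
  assume "finite {(i, j). f i j \<noteq> 0}" "finite {(i, j). g i j \<noteq> 0}"
  then obtain m n where
    m: "\<forall>i j. f i j \<noteq> 0 \<longrightarrow> i < m \<and> j < m" and n: "\<forall>i j. g i j \<noteq> 0 \<longrightarrow> i < n \<and> j < n"
    unfolding finite_support_iff by blast
  have "i < max m n \<and> j < max m n" if "Sum_any (\<lambda>k. f i k * g k j) \<noteq> 0" for i j
  proof -
    obtain k where "f i k * g k j \<noteq> 0"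
      using \<open>Sum_any (\<lambda>k. f i k * g k j) \<noteq> 0\<close>
      by (rule Sum_any.not_neutral_obtains_not_neutral)
    then have "f i k \<noteq> 0" "g k j \<noteq> 0" by auto
    then show ?thesis using m n by fastforce
  qed
  then show "finite {(i, j). Sum_any (\<lambda>k. f i k * g k j) \<noteq> 0}"
    unfolding finite_support_iff by blast
qed

lemma entry_times_sum:
  assumes "\<And>i j. n \<le> i \<or> n \<le> j \<Longrightarrow> entry M i j = 0"
  shows "entry (M * N) i j = (\<Sum>k<n. entry M i k * entry N k j)"
  unfolding times_fsmat.rep_eq using assms by (intro Sum_any_lessThan) simp

instance
proof
  fix M N P :: "'a fsmat"
  obtain m where m: "\<And>i j. m \<le> i \<or> m \<le> j \<Longrightarrow> entry M i j = 0"
    using entry_bound[of M] by blast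
  obtain n where n: "\<And>i j. n \<le> i \<or> n \<le> j \<Longrightarrow> entry N i j = 0"
    using entry_bound[of N] by blast
  show "M * N * P = M * (N * P)"
  proof (rule fsmat_eqI)
    fix i j
    have "entry (M * N * P) i j = (\<Sum>k<n. entry (M * N) i k * entry P k j)"
      unfolding times_fsmat.rep_eq[of "M * N" P]
      by (intro Sum_any_lessThan) (simp add: entry_times_sum[OF m] n)
    also have "\<dots> = (\<Sum>k<n. \<Sum>l<m. entry M i l * entry N l k * entry P k j)"
      by (simp add: entry_times_sum[OF m] sum_distrib_right)
    also have "\<dots> = (\<Sum>l<m. \<Sum>k<n. entry M i l * entry N l k * entry P k j)"
      by (rule sum.swap)
    also have "\<dots> = entry (M * (N * P)) i j"
      by (simp add: entry_times_sum[OF m] entry_times_sum[OF n] sum_distrib_left mult.assoc)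
    finally show "entry (M * N * P) i j = entry (M * (N * P)) i j" .
  qed
  show "M * (N + P) = M * N + M * P"
    by (rule fsmat_eqI)
      (simp add: plus_fsmat.rep_eq entry_times_sum[OF m] distrib_left sum.distrib)
  show "(M + N) * P = M * P + N * P"
  proof (rule fsmat_eqI)
    fix i j
    let ?k = "max m n"
    have bounds: "\<And>i j. ?k \<le> i \<or> ?k \<le> j \<Longrightarrow> entry M i j = 0"
      "\<And>i j. ?k \<le> i \<or> ?k \<le> j \<Longrightarrow> entry N i j = 0"
      "\<And>i j. ?k \<le> i \<or> ?k \<le> j \<Longrightarrow> entry (M + N) i j = 0"
      using m n by (auto simp: plus_fsmat.rep_eq)
    have "entry ((M + N) * P) i j = (\<Sum>k<?k. entry (M + N) i k * entry P k j)"
      by (rule entry_times_sum) (rule bounds)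
    also have "\<dots> = (\<Sum>k<?k. entry M i k * entry P k j) + (\<Sum>k<?k. entry N i k * entry P k j)"
      by (simp add: plus_fsmat.rep_eq distrib_right sum.distrib)
    also have "\<dots> = entry (M * P + N * P) i j"
      by (simp only: plus_fsmat.rep_eq
          entry_times_sum[of ?k M P, OF bounds(1)] entry_times_sum[of ?k N P, OF bounds(2)])
    finally show "entry ((M + N) * P) i j = entry (M * P + N * P) i j" .
  qed
qed (transfer; simp add: algebra_simps)+

end

instantiation fsmat :: (complex_star_algebra) complex_star_algebra
begin

lift_definition scaleC_fsmat :: "complex \<Rightarrow> 'a fsmat \<Rightarrow> 'a fsmat"
  is "\<lambda>c f i j. c *\<^sub>C f i j"
proof -
  fix c and f :: "nat \<Rightarrow> nat \<Rightarrow> 'a"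
  assume "finite {(i, j). f i j \<noteq> 0}"
  then show "finite {(i, j). c *\<^sub>C f i j \<noteq> 0}"
    by (rule finite_subset[rotated]) auto
qed

lift_definition star_fsmat :: "'a fsmat \<Rightarrow> 'a fsmat" is "\<lambda>f i j. star (f j i)"
proof -
  fix f :: "nat \<Rightarrow> nat \<Rightarrow> 'a"
  assume "finite {(i, j). f i j \<noteq> 0}"
  then obtain n where "\<forall>i j. f i j \<noteq> 0 \<longrightarrow> i < n \<and> j < n"
    unfolding finite_support_iff by blast
  then have "\<forall>i j. star (f j i) \<noteq> 0 \<longrightarrow> i < n \<and> j < n"
    using star_zero by metis
  then show "finite {(i, j). star (f j i) \<noteq> 0}"
    unfolding finite_support_iff by blast
qed

instance
proof
  fix M N :: "'a fsmat" and c d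
  obtain n where n: "\<And>i j. n \<le> i \<or> n \<le> j \<Longrightarrow> entry M i j = 0"
    using entry_bound[of M] by blast
  have cn: "entry (c *\<^sub>C M) i j = 0" if "n \<le> i \<or> n \<le> j" for i j
    using n[OF that] by (simp add: scaleC_fsmat.rep_eq)
  have scaleC_sum: "c *\<^sub>C sum f {..<k} = (\<Sum>l<k. c *\<^sub>C f l)" for f :: "nat \<Rightarrow> 'a" and k
    by (induction k) (simp_all add: scaleC_add_right)
  have star_sum: "star (sum f {..<k}) = (\<Sum>l<k. star (f l))" for f :: "nat \<Rightarrow> 'a" and k
    by (induction k) (simp_all add: star_add)
  show "(c *\<^sub>C M) * N = c *\<^sub>C (M * N)"
    by (rule fsmat_eqI)
      (simp add: entry_times_sum[OF cn] scaleC_fsmat.rep_eq entry_times_sum[OF n] scaleC_sum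
        mult_scaleC_left)
  show "M * (c *\<^sub>C N) = c *\<^sub>C (M * N)"
    by (rule fsmat_eqI)
      (simp add: scaleC_fsmat.rep_eq entry_times_sum[OF n] scaleC_sum mult_scaleC_right)
  show "star (M * N) = star N * star M"
  proof (rule fsmat_eqI)
    fix i j
    have "entry (star N * star M) i j = (\<Sum>k<n. entry (star N) i k * entry (star M) k j)"
      unfolding times_fsmat.rep_eq by (intro Sum_any_lessThan) (simp add: star_fsmat.rep_eq n)
    then show "entry (star (M * N)) i j = entry (star N * star M) i j"
      by (simp add: star_fsmat.rep_eq entry_times_sum[OF n] star_sum star_mult)
  qed
qed (transfer; simp add: scaleC_add_right scaleC_add_left scaleC_scaleC scaleC_one
    star_add star_scaleC star_star)+

end

text \<open>
  When the entry type \<open>A\<close> is a unital C*-algebra, the C*-norm of a matrix is its operator norm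
  for the left action on finitely supported columns with entries in \<open>A\<close>, where the column \<open>x\<close> has the Hilbert module norm
  \<open>\<parallel>\<Sum>\<^sub>i x\<^sub>i\<^sup>* x\<^sub>i\<parallel>\<^sup>1\<^sup>/\<^sup>2\<close>. For a matrix in \<open>M\<^sub>n(A)\<close>, only the first \<open>n\<close> entries of a column matter,
  so this is the norm of \<open>M\<^sub>n(A)\<close> acting on \<open>A\<^sup>n\<close>.
\<close>

definition column_norm :: "(nat \<Rightarrow> 'a::star_algebra_with_norm) \<Rightarrow> real" where
  "column_norm x = sqrt (cstar_norm (Sum_any (\<lambda>i. star (x i) * x i)))"

instantiation fsmat :: (star_algebra_with_norm) star_algebra_with_norm
begin

definition cstar_norm_fsmat :: "'a fsmat \<Rightarrow> real" where
  "cstar_norm_fsmat M =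
    (SUP x \<in> {x :: nat \<Rightarrow> 'a. finite {j. x j \<noteq> 0} \<and> column_norm x \<le> 1}.
      column_norm (\<lambda>i. Sum_any (\<lambda>j. entry M i j * x j)))"

instance ..

end

definition matrices :: "nat \<Rightarrow> 'a::zero set \<Rightarrow> 'a fsmat set" where
  "matrices n A =
    {M. (\<forall>i<n. \<forall>j<n. entry M i j \<in> A) \<and> (\<forall>i j. n \<le> i \<or> n \<le> j \<longrightarrow> entry M i j = 0)}"

lift_definition one_matrix :: "nat \<Rightarrow> 'a::zero_neq_one fsmat"
  is "\<lambda>n i j. if i = j \<and> i < n then 1 else 0"
proof -
  fix n :: nat
  show "finite {(i, j). (if i = j \<and> i < n then 1 else 0) \<noteq> (0 :: 'a)}"
    unfolding finite_support_iff by (metis (mono_tags, lifting))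
qed


section \<open>Notions relative to a C*-algebra given by its carrier\<close>

text \<open>
  From here on a C*-algebra is a subset \<open>A\<close> of an ambient star-algebra with a norm, and \<open>e\<close>
  denotes its unit; this covers types of class \<^class>\<open>unital_cstar_algebra\<close>, their unital
  subalgebras, and the matrix algebras over these.
\<close>

definition norm_closed_in :: "'a::star_algebra_with_norm set \<Rightarrow> 'a set \<Rightarrow> bool" where
  "norm_closed_in A S \<longleftrightarrow>
    (\<forall>f l. range f \<subseteq> S \<and> l \<in> A \<and> (\<lambda>n::nat. cstar_norm (f n - l)) \<longlonglongrightarrow> 0 \<longrightarrow> l \<in> S)"

definition unital_cstar_subalgebra :: "'a::star_algebra_with_norm set \<Rightarrow> 'a \<Rightarrow> 'a set \<Rightarrow> bool" where
  "unital_cstar_subalgebra A e B \<longleftrightarrow>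
    B \<subseteq> A \<and> e \<in> B \<and>
    (\<forall>x\<in>B. \<forall>y\<in>B. x + y \<in> B \<and> x * y \<in> B) \<and>
    (\<forall>c. \<forall>x\<in>B. c *\<^sub>C x \<in> B) \<and>
    (\<forall>x\<in>B. star x \<in> B) \<and>
    norm_closed_in A B"

definition closed_ideal :: "'a::star_algebra_with_norm set \<Rightarrow> 'a set \<Rightarrow> bool" where
  "closed_ideal A J \<longleftrightarrow>
    J \<subseteq> A \<and> 0 \<in> J \<and>
    (\<forall>x\<in>J. \<forall>y\<in>J. x + y \<in> J) \<and>
    (\<forall>c. \<forall>x\<in>J. c *\<^sub>C x \<in> J) \<and>
    (\<forall>a\<in>A. \<forall>x\<in>J. a * x \<in> J \<and> x * a \<in> J) \<and>
    norm_closed_in A J"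

definition simple :: "'a::star_algebra_with_norm set \<Rightarrow> bool" where
  "simple A \<longleftrightarrow> A \<noteq> {0} \<and> (\<forall>J. closed_ideal A J \<longrightarrow> J = {0} \<or> J = A)"

definition infinite_dimensional :: "'a::complex_star_algebra set \<Rightarrow> bool" where
  "infinite_dimensional A \<longleftrightarrow> \<not> (\<exists>S. finite S \<and> S \<subseteq> A \<and> A \<subseteq> module.span scaleC S)"

definition spectrum :: "'a::complex_star_algebra set \<Rightarrow> 'a \<Rightarrow> 'a \<Rightarrow> complex set" where
  "spectrum A e a = {c. \<not> (\<exists>b\<in>A. b * (a - c *\<^sub>C e) = e \<and> (a - c *\<^sub>C e) * b = e)}"

definition positive :: "'a::complex_star_algebra set \<Rightarrow> 'a \<Rightarrow> 'a \<Rightarrow> bool" where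
  "positive A e a \<longleftrightarrow> a \<in> A \<and> star a = a \<and> spectrum A e a \<subseteq> \<real>\<^sub>\<ge>\<^sub>0"

text \<open>Only meant for positive elements \<open>a\<close> and \<open>b\<close> of \<open>D\<close>.\<close>

definition cuntz_below :: "'a::star_algebra_with_norm set \<Rightarrow> 'a \<Rightarrow> 'a \<Rightarrow> bool" where
  "cuntz_below D a b \<longleftrightarrow>
    (\<exists>v. range v \<subseteq> D \<and> (\<lambda>n::nat. cstar_norm (v n * b * star (v n) - a)) \<longlonglongrightarrow> 0)"

definition large :: "'a::star_algebra_with_norm set \<Rightarrow> 'a \<Rightarrow> 'a set \<Rightarrow> bool" where
  "large A e B \<longleftrightarrow>
    unital_cstar_subalgebra A e B \<and>
    (\<forall>m::nat. \<forall>a. \<forall>\<epsilon>::real. \<forall>x y.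
      1 \<le> m \<and> (\<forall>j\<in>{1..m}. a j \<in> A) \<and> 0 < \<epsilon> \<and>
      positive A e x \<and> cstar_norm x = 1 \<and> positive B e y \<and> y \<noteq> 0 \<longrightarrow>
      (\<exists>c g. (\<forall>j\<in>{1..m}. c j \<in> A) \<and> g \<in> B \<and>
        positive B e g \<and> positive B e (e - g) \<and>
        (\<forall>j\<in>{1..m}. cstar_norm (c j - a j) < \<epsilon>) \<and>
        (\<forall>j\<in>{1..m}. (e - g) * c j \<in> B) \<and>
        cuntz_below B g y \<and> cuntz_below A g x \<and>
        cstar_norm ((e - g) * x * (e - g)) > 1 - \<epsilon>))"

definition finite_alg :: "'a::complex_star_algebra set \<Rightarrow> 'a \<Rightarrow> bool" where
  "finite_alg A e \<longleftrightarrow> (\<forall>s\<in>A. star s * s = e \<longrightarrow> s * star s = e)"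

definition stably_large :: "'a::unital_cstar_algebra set \<Rightarrow> 'a set \<Rightarrow> bool" where
  "stably_large A B \<longleftrightarrow> (\<forall>n\<ge>1. large (matrices n A) (one_matrix n) (matrices n B))"

definition stably_finite :: "'a::unital_cstar_algebra set \<Rightarrow> bool" where
  "stably_finite A \<longleftrightarrow> (\<forall>n\<ge>1. finite_alg (matrices n A) (one_matrix n))"

end

theory Submission
  imports Defs
begin

text \<open>
  Only the passage from \<open>B\<close> to \<open>A\<close> needs an argument. Suppose \<open>M\<^sub>n(A)\<close> contains an isometry \<open>s\<close>
  with \<open>p = 1 - ss\<^sup>* \<noteq> 0\<close>. The projections \<open>s\<^sup>qps\<^sup>*\<^sup>q\<close> are orthogonal, and by simplicity finitely
  many of them dominate any multiple of the unit, so for every \<open>K\<close> there are \<open>L, R \<in> M\<^sub>K(A)\<close> with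
  \<open>LR = 1\<close> and \<open>R = eR\<close>, where \<open>e\<close> is the unit of the corner \<open>M\<^sub>n(A)\<close>. Take \<open>K = 2n + 1\<close> and apply
  largeness in \<open>M\<^sub>K(A)\<close> to \<open>L\<close> and \<open>y = e\<close>: there are \<open>c\<close> near \<open>L\<close> and \<open>g \<in> M\<^sub>K(B)\<close> with
  \<open>(1 - g)c \<in> M\<^sub>K(B)\<close> and \<open>g \<approx> vev\<^sup>*\<close>, \<open>v \<in> M\<^sub>K(B)\<close>. If \<open>J\<close> is the partial isometry with \<open>JJ\<^sup>* = e\<close>
  onto a second corner, then \<open>w = (1 - g)ce + vJ \<in> M\<^sub>K(B)\<close> satisfies
  \<open>w(R + J\<^sup>*v\<^sup>*) \<approx> (1 - g) + vev\<^sup>* \<approx> 1\<close>, up to an intermediate correction of \<open>R\<close>. So \<open>w\<close> is right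
  invertible but kills the last basis vector; orthonormalizing its rows inside \<open>B\<close> gives a
  coisometry in \<open>M\<^sub>K(B)\<close> that is not unitary.

  Orthonormalization and the comparison of the operator norm on \<open>M\<^sub>K(A)\<close> with the norms of the
  entries rest on the positivity of \<open>a\<^sup>*a\<close>, which is obtained without spectral theory.
\<close>

section \<open>Order and square roots in a unital C*-algebra\<close>

lemma star_uminus: "star (- x :: 'a::complex_star_algebra) = - star x"
  using star_add[of x "- x"] by (simp add: eq_neg_iff_add_eq_0 add.commute)

lemma star_diff: "star (x - y :: 'a::complex_star_algebra) = star x - star y"
  using star_add[of x "- y"] by (simp add: star_uminus)

lemma star_sum: "star (sum f A :: 'a::complex_star_algebra) = (\<Sum>i\<in>A. star (f i))"
  by (induction A rule: infinite_finite_induct) (simp_all add: star_add)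

lemma scaleC_minus_left: "(- c) *\<^sub>C x = - (c *\<^sub>C (x :: 'a::complex_star_algebra))"
  using scaleC_add_left[of c "- c" x] scaleC_add_left[of 0 0 x]
  by (simp add: eq_neg_iff_add_eq_0 add.commute)

lemma scaleC_zero_left [simp]: "0 *\<^sub>C x = (0 :: 'a::complex_star_algebra)"
  using scaleC_add_left[of 0 0 x] by simp

lemma scaleC_minus_right: "c *\<^sub>C (- x) = - (c *\<^sub>C (x :: 'a::complex_star_algebra))"
  using scaleC_add_right[of c x "- x"] by (simp add: eq_neg_iff_add_eq_0 add.commute)

lemma scaleC_diff_right: "c *\<^sub>C (x - y) = c *\<^sub>C x - c *\<^sub>C (y :: 'a::complex_star_algebra)"
  using scaleC_add_right[of c x "- y"] by (simp add: scaleC_minus_right)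

lemma star_one [simp]: "star 1 = (1 :: 'a::unital_cstar_algebra)"
  by (metis mult.left_neutral mult.right_neutral star_mult star_star)

lemma star_scaleR: "star (r *\<^sub>R x) = r *\<^sub>R star (x :: 'a::unital_cstar_algebra)"
  by (simp add: scaleR_scaleC star_scaleC)

lemma star_power: "star (x ^ n) = star (x :: 'a::unital_cstar_algebra) ^ n"
  by (induction n) (simp_all add: star_mult power_commutes)

lemma norm_star [simp]: "norm (star x) = norm (x :: 'a::unital_cstar_algebra)"
proof -
  have le: "norm y \<le> norm (star y)" for y :: 'a
  proof (cases "y = 0")
    case False
    have "(norm y)\<^sup>2 \<le> norm (star y) * norm y"
      using cstar_identity[of y] norm_mult_ineq[of "star y" y] by simp
    then show ?thesis using False by (simp add: power2_eq_square)
  qed simp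
  show ?thesis using le[of x] le[of "star x"] by (simp add: star_star)
qed

lemma bounded_linear_star: "bounded_linear (star :: 'a::unital_cstar_algebra \<Rightarrow> 'a)"
  by (rule bounded_linear_intro[where K = 1]) (simp_all add: star_add star_scaleR)

text \<open>The C*-identity only squares, so the exact formula is proved along the exponents
  \<open>2 ^ n\<close>. It takes the place of the spectral radius formula in the growth arguments
  below.\<close>

lemma norm_selfadjoint_power:
  fixes x :: "'a::unital_cstar_algebra"
  assumes "star x = x"
  shows "norm (x ^ 2 ^ n) = norm x ^ 2 ^ n"
proof (induction n)
  case (Suc n)
  have "norm (x ^ 2 ^ Suc n) = norm (star (x ^ 2 ^ n) * x ^ 2 ^ n)"
    by (simp add: star_power assms mult_2 power_add)
  also have "\<dots> = (norm (x ^ 2 ^ n))\<^sup>2" by (rule cstar_identity)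
  finally show ?case by (simp add: Suc power_mult mult.commute flip: power_mult)
qed simp

section \<open>Exponentials\<close>

lemma star_exp: "star (exp x) = exp (star (x :: 'a::unital_cstar_algebra))"
proof -
  have "(\<lambda>n. star (x ^ n /\<^sub>R fact n)) sums star (exp x)"
    by (rule bounded_linear.sums[OF bounded_linear_star exp_converges])
  then have "(\<lambda>n. star x ^ n /\<^sub>R fact n) sums star (exp x)"
    by (simp add: star_scaleR star_power)
  then show ?thesis using exp_converges sums_unique2 by blast
qed

text \<open>\<open>star\<close> turns \<open>\<i> *\<^sub>C x\<close> into its negative, hence the
  exponential into its inverse.\<close>

lemma norm_exp_imaginary:
  fixes x :: "'a::unital_cstar_algebra"
  assumes "star x = x"
  shows "norm (exp (\<i> *\<^sub>C x)) = 1"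
proof -
  have "star (exp (\<i> *\<^sub>C x)) * exp (\<i> *\<^sub>C x) = 1"
    by (simp add: star_exp star_scaleC assms scaleC_minus_left exp_minus_inverse[of "- (\<i> *\<^sub>C x)", simplified])
  then show ?thesis using cstar_identity[of "exp (\<i> *\<^sub>C x)"]
    by (simp add: power2_eq_1_iff) (smt (verit) norm_ge_zero)
qed

text \<open>The remainder series is dominated term by term by the scalar one at \<open>r\<close>, to
  which the Lagrange form of the remainder applies.\<close>

lemma norm_exp_taylor:
  fixes y :: "'a::{real_normed_algebra_1,banach}"
  assumes "norm y \<le> r"
  shows "norm (exp y - (\<Sum>n<N. y ^ n /\<^sub>R fact n)) \<le> exp r / fact N * r ^ N"
proof -
  have r: "0 \<le> r" using assms norm_ge_zero order_trans by blast
  have s1: "(\<lambda>n. y ^ (n + N) /\<^sub>R fact (n + N)) sums (exp y - (\<Sum>n<N. y ^ n /\<^sub>R fact n))"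
    by (rule sums_split_initial_segment[OF exp_converges])
  have s2: "(\<lambda>n. r ^ (n + N) /\<^sub>R fact (n + N)) sums (exp r - (\<Sum>n<N. r ^ n /\<^sub>R fact n))"
    by (rule sums_split_initial_segment[OF exp_converges])
  have "norm (exp y - (\<Sum>n<N. y ^ n /\<^sub>R fact n)) \<le> exp r - (\<Sum>n<N. r ^ n /\<^sub>R fact n)"
  proof (rule norm_sums_le[OF s1 s2])
    fix n
    have "norm (y ^ (n + N)) \<le> r ^ (n + N)"
      using norm_power_ineq[of y "n + N"] power_mono[OF assms norm_ge_zero, of "n + N"] by linarith
    then show "norm (y ^ (n + N) /\<^sub>R fact (n + N)) \<le> r ^ (n + N) /\<^sub>R fact (n + N)"
      by (simp add: mult_left_mono)
  qed
  also obtain t where t: "\<bar>t\<bar> \<le> \<bar>r\<bar>" "exp r = (\<Sum>m<N. r ^ m / fact m) + exp t / fact N * r ^ N"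
    using Maclaurin_exp_le[of r N] by blast
  have "exp r - (\<Sum>n<N. r ^ n /\<^sub>R fact n) = exp t / fact N * r ^ N"
    using t(2) by (simp add: divide_inverse mult.commute)
  also have "\<dots> \<le> exp r / fact N * r ^ N"
    using t(1) r by (intro mult_right_mono divide_right_mono) auto
  finally show ?thesis .
qed

section \<open>Order through one-sided bounds on the numerical range\<close>

text \<open>
  \<open>nle k \<mu>\<close> says that the real parts of the numerical range of \<open>k\<close> are bounded by \<open>\<mu>\<close>; for
  selfadjoint \<open>k\<close> this is \<open>k \<le> \<mu>\<close>, and in this form sums of positive elements are positive
  for trivial reasons.
\<close>

definition nle :: "'a::real_normed_algebra_1 \<Rightarrow> real \<Rightarrow> bool" where
  "nle k \<mu> \<longleftrightarrow> (\<forall>\<epsilon>>0. \<exists>d>0. \<forall>t. 0 < t \<and> t \<le> d \<longrightarrow> norm (1 + t *\<^sub>R k) \<le> 1 + (\<mu> + \<epsilon>) * t)"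

lemma nleD:
  assumes "nle k \<mu>" "\<mu> < \<nu>"
  obtains d where "0 < d" "\<And>t. 0 < t \<Longrightarrow> t \<le> d \<Longrightarrow> norm (1 + t *\<^sub>R k) \<le> 1 + \<nu> * t"
  using assms unfolding nle_def by (metis add.commute diff_add_cancel diff_gt_0_iff_gt)

lemma nle_norm: "norm k \<le> \<mu> \<Longrightarrow> nle k \<mu>"
  unfolding nle_def
proof (intro allI impI exI[of _ 1] conjI)
  fix \<epsilon> t :: real
  assume a: "norm k \<le> \<mu>" "0 < \<epsilon>" "0 < t \<and> t \<le> 1"
  have "norm (1 + t *\<^sub>R k) \<le> 1 + t * norm k"
    using norm_triangle_ineq[of 1 "t *\<^sub>R k"] a by simp
  also have "\<dots> \<le> 1 + (\<mu> + \<epsilon>) * t" using a by (simp add: mult.commute mult_left_mono)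
  finally show "norm (1 + t *\<^sub>R k) \<le> 1 + (\<mu> + \<epsilon>) * t" .
qed simp

lemma nle_zero [simp]: "nle 0 0" by (rule nle_norm) simp

lemma nle_add:
  assumes "nle k \<mu>" "nle l \<nu>"
  shows "nle (k + l) (\<mu> + \<nu>)"
  unfolding nle_def
proof (intro allI impI)
  fix \<epsilon> :: real assume e: "0 < \<epsilon>"
  obtain d where d: "0 < d" "\<And>t. 0 < t \<Longrightarrow> t \<le> d \<Longrightarrow> norm (1 + t *\<^sub>R k) \<le> 1 + (\<mu> + \<epsilon> / 2) * t"
    using nleD[OF assms(1), of "\<mu> + \<epsilon> / 2"] e by auto
  obtain d' where d': "0 < d'" "\<And>t. 0 < t \<Longrightarrow> t \<le> d' \<Longrightarrow> norm (1 + t *\<^sub>R l) \<le> 1 + (\<nu> + \<epsilon> / 2) * t"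
    using nleD[OF assms(2), of "\<nu> + \<epsilon> / 2"] e by auto
  have "norm (1 + t *\<^sub>R (k + l)) \<le> 1 + (\<mu> + \<nu> + \<epsilon>) * t" if t: "0 < t" "t \<le> min d d' / 2" for t
  proof -
    \<comment> \<open>A midpoint of two elements with parameter \<open>2 * t\<close>; this is why
      the admissible range of \<open>t\<close> is halved.\<close>
    have "1 + t *\<^sub>R (k + l) = (1 / 2) *\<^sub>R (1 + (2 * t) *\<^sub>R k) + (1 / 2) *\<^sub>R (1 + (2 * t) *\<^sub>R l)"
      by (simp add: algebra_simps flip: scaleR_2)
    then have "norm (1 + t *\<^sub>R (k + l)) \<le> norm (1 + (2 * t) *\<^sub>R k) / 2 + norm (1 + (2 * t) *\<^sub>R l) / 2"
      using norm_triangle_ineq[of "(1 / 2) *\<^sub>R (1 + (2 * t) *\<^sub>R k)" "(1 / 2) *\<^sub>R (1 + (2 * t) *\<^sub>R l)"]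
      by simp
    also have "\<dots> \<le> (1 + (\<mu> + \<epsilon> / 2) * (2 * t)) / 2 + (1 + (\<nu> + \<epsilon> / 2) * (2 * t)) / 2"
      using d(2)[of "2 * t"] d'(2)[of "2 * t"] t by (intro add_mono divide_right_mono) auto
    finally show ?thesis by (simp add: field_simps)
  qed
  then show "\<exists>d>0. \<forall>t. 0 < t \<and> t \<le> d \<longrightarrow> norm (1 + t *\<^sub>R (k + l)) \<le> 1 + (\<mu> + \<nu> + \<epsilon>) * t"
    using d(1) d'(1) by (intro exI[of _ "min d d' / 2"]) auto
qed

lemma nle_scaleR:
  assumes "nle k \<mu>" "0 \<le> c"
  shows "nle (c *\<^sub>R k) (c * \<mu>)"
proof (cases "c = 0")
  case False
  then have c: "0 < c" using assms(2) by simp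
  show ?thesis
    unfolding nle_def
  proof (intro allI impI)
    fix \<epsilon> :: real assume e: "0 < \<epsilon>"
    obtain d where d: "0 < d" "\<And>t. 0 < t \<Longrightarrow> t \<le> d \<Longrightarrow> norm (1 + t *\<^sub>R k) \<le> 1 + (\<mu> + \<epsilon> / c) * t"
      using nleD[OF assms(1), of "\<mu> + \<epsilon> / c"] e c by auto
    have "norm (1 + t *\<^sub>R c *\<^sub>R k) \<le> 1 + (c * \<mu> + \<epsilon>) * t" if t: "0 < t" "t \<le> d / c" for t
    proof -
      have "norm (1 + (t * c) *\<^sub>R k) \<le> 1 + (\<mu> + \<epsilon> / c) * (t * c)"
        using d(2)[of "t * c"] t c by (simp add: pos_le_divide_eq)
      also have "(\<mu> + \<epsilon> / c) * (t * c) = (c * \<mu> + \<epsilon>) * t" using c by (simp add: field_simps)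
      finally show ?thesis by simp
    qed
    then show "\<exists>d>0. \<forall>t. 0 < t \<and> t \<le> d \<longrightarrow> norm (1 + t *\<^sub>R c *\<^sub>R k) \<le> 1 + (c * \<mu> + \<epsilon>) * t"
      using d(1) c by (intro exI[of _ "d / c"]) auto
  qed
qed simp

lemma nle_sum_nonpos:
  "(\<And>i. i \<in> A \<Longrightarrow> nle (f i) 0) \<Longrightarrow> nle (sum f A) 0"
proof (induction A rule: infinite_finite_induct)
  case (insert x F)
  then show ?case using nle_add[of "f x" 0 "sum f F" 0] by simp
qed simp_all

lemma exp_scaleR_of_nat:
  fixes x :: "'a::{real_normed_algebra_1,banach}"
  shows "exp (real n *\<^sub>R x) = exp x ^ n"
proof (induction n)
  case (Suc n)
  have "exp (real (Suc n) *\<^sub>R x) = exp (x + real n *\<^sub>R x)" by (simp add: algebra_simps)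
  also have "\<dots> = exp x * exp (real n *\<^sub>R x)" by (rule exp_add_commuting) simp
  finally show ?case by (simp add: Suc)
qed simp

text \<open>Write \<open>s\<close> as \<open>N\<close> steps of small length \<open>t\<close>. To
  first order one step is \<open>1 + t *\<^sub>R k\<close>, and the gap between \<open>\<mu>\<close>
  and \<open>\<nu>\<close> absorbs the quadratic remainder before \<open>N\<close>-th powers are
  taken.\<close>

lemma norm_exp_nle:
  fixes k :: "'a::{real_normed_algebra_1,banach}"
  assumes "nle k \<mu>" "\<mu> < \<nu>" "0 \<le> s"
  shows "norm (exp (s *\<^sub>R k)) \<le> exp (\<nu> * s)"
proof (cases "s = 0")
  case False
  then have s: "0 < s" using assms(3) by simp
  define \<delta> where "\<delta> = (\<nu> - \<mu>) / 2"
  have \<delta>: "0 < \<delta>" using assms(2) by (simp add: \<delta>_def)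
  obtain d where d: "0 < d" "\<And>t. 0 < t \<Longrightarrow> t \<le> d \<Longrightarrow> norm (1 + t *\<^sub>R k) \<le> 1 + (\<mu> + \<delta>) * t"
    using nleD[OF assms(1), of "\<mu> + \<delta>"] \<delta> by auto
  define B where "B = 1 + norm k"
  have B: "1 \<le> B" "norm k \<le> B" by (simp_all add: B_def)
  \<comment> \<open>The bound \<open>1 / B\<close> gives \<open>t * B \<le> 1\<close>, so the
    exponential factor is at most 3; the third bound makes the Taylor remainder at most
    \<open>\<delta> * t\<close>.\<close>
  define D where "D = Min {d, 1 / B, \<delta> / (3 * B\<^sup>2)}"
  have D: "0 < D" "D \<le> d" "D \<le> 1 / B" "D \<le> \<delta> / (3 * B\<^sup>2)"
    unfolding D_def using d(1) B \<delta> by auto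
  obtain N :: nat where N: "N > s / D" using reals_Archimedean2 by blast
  have N0: "0 < real N" using N s D(1) by (smt (verit) divide_pos_pos)
  define t where "t = s / N"
  have t: "0 < t" "t \<le> D" using N N0 s D(1) by (auto simp: t_def field_simps)
  have "t \<le> 1 / B" "t \<le> \<delta> / (3 * B\<^sup>2)" using t D(3,4) by linarith+
  then have tB: "t * B \<le> 1" "3 * (t * B\<^sup>2) \<le> \<delta>"
    using B by (simp_all add: pos_le_divide_eq mult_ac)
  have "norm (exp (t *\<^sub>R k) - (\<Sum>n<2. (t *\<^sub>R k) ^ n /\<^sub>R fact n)) \<le> exp (t * B) / fact 2 * (t * B) ^ 2"
    by (rule norm_exp_taylor) (use B t in \<open>simp add: mult_left_mono\<close>)
  also have "\<dots> \<le> 3 * (t * B)\<^sup>2"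
  proof -
    have "exp (t * B) \<le> 3" using tB(1) exp_le order_trans exp_le_cancel_iff by blast
    then show ?thesis by (intro mult_right_mono) (auto simp: fact_2)
  qed
  also have "\<dots> \<le> \<delta> * t" using mult_right_mono[OF tB(2), of t] t by (simp add: power2_eq_square algebra_simps)
  finally have "norm (exp (t *\<^sub>R k) - (1 + t *\<^sub>R k)) \<le> \<delta> * t" by (simp add: numeral_2_eq_2)
  then have "norm (exp (t *\<^sub>R k)) \<le> norm (1 + t *\<^sub>R k) + \<delta> * t"
    using norm_triangle_sub[of "exp (t *\<^sub>R k)" "1 + t *\<^sub>R k"] by linarith
  also have "\<dots> \<le> 1 + \<nu> * t" using d(2)[of t] t D(2) by (simp add: \<delta>_def algebra_simps field_simps)
  also have "\<dots> \<le> exp (\<nu> * t)" by (rule exp_ge_add_one_self)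
  finally have le: "norm (exp (t *\<^sub>R k)) \<le> exp (\<nu> * t)" .
  have "exp (s *\<^sub>R k) = exp (t *\<^sub>R k) ^ N"
    using N0 exp_scaleR_of_nat[of N "t *\<^sub>R k"] by (simp add: t_def)
  then have "norm (exp (s *\<^sub>R k)) \<le> norm (exp (t *\<^sub>R k)) ^ N" by (simp add: norm_power_ineq)
  also have "\<dots> \<le> exp (\<nu> * t) ^ N" by (intro power_mono le norm_ge_zero)
  also have "\<dots> = exp (\<nu> * s)" using N0 by (simp add: t_def flip: exp_of_nat_mult)
  finally show ?thesis .
qed simp

text \<open>A cosine argument: for \<open>y\<close> equal to \<i> sqrt(2t) x the mean of
  \<open>exp y\<close> and \<open>exp (- y)\<close> has norm at most 1, and it agrees with 1 - t x^2
  up to a remainder of order t^(3/2).\<close>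

lemma nle_square:
  fixes x :: "'a::unital_cstar_algebra"
  assumes "star x = x"
  shows "nle (- (x * x)) 0"
  unfolding nle_def
proof (intro allI impI)
  fix \<epsilon> :: real assume e: "0 < \<epsilon>"
  define B where "B = 1 + norm x"
  have B: "1 \<le> B" "norm x \<le> B" by (simp_all add: B_def)
  \<comment> \<open>The first bound ensures \<open>\<sigma> * B \<le> 1\<close>, the second
    \<open>2 * \<sigma> * B ^ 3 \<le> \<epsilon>\<close>; as
    \<open>\<sigma>\<^sup>2 = 2 * t\<close>, the latter turns the cubic remainder into at most
    \<open>\<epsilon> * t\<close>.\<close>
  define d where "d = min (1 / (2 * B\<^sup>2)) (\<epsilon>\<^sup>2 / (8 * B ^ 6))"
  have d: "0 < d" using B e by (simp add: d_def)
  have "norm (1 + t *\<^sub>R - (x * x)) \<le> 1 + (0 + \<epsilon>) * t" if t: "0 < t" "t \<le> d" for t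
  proof -
    define \<sigma> where "\<sigma> = sqrt (2 * t)"
    have \<sigma>: "0 < \<sigma>" "\<sigma>\<^sup>2 = 2 * t" using t by (auto simp: \<sigma>_def)
    have "t * (2 * B\<^sup>2) \<le> 1" "t * (8 * B ^ 6) \<le> \<epsilon>\<^sup>2" using t(2) B by (auto simp: d_def field_simps)
    then have "(\<sigma> * B)\<^sup>2 \<le> 1\<^sup>2" "(2 * \<sigma> * B ^ 3)\<^sup>2 \<le> \<epsilon>\<^sup>2"
      by (simp_all add: power_mult_distrib \<sigma>(2) mult_ac flip: power_mult)
    then have s: "\<sigma> * B \<le> 1" "2 * \<sigma> * B ^ 3 \<le> \<epsilon>"
      using power2_le_imp_le e by (auto intro: power2_le_imp_le)
    define y where "y = \<i> *\<^sub>C \<sigma> *\<^sub>R x"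
    have ny: "norm y \<le> \<sigma> * B" using B \<sigma> by (simp add: y_def norm_scaleC)
    have yy: "y * y = - (2 * t) *\<^sub>R (x * x)"
    proof -
      have "y = (\<i> * \<sigma>) *\<^sub>C x" by (simp add: y_def scaleR_scaleC scaleC_scaleC)
      then have "y * y = (\<i> * \<sigma> * (\<i> * \<sigma>)) *\<^sub>C (x * x)"
        by (simp add: mult_scaleC_left mult_scaleC_right scaleC_scaleC)
      also have "\<i> * \<sigma> * (\<i> * \<sigma>) = - complex_of_real (\<sigma> * \<sigma>)" by (simp add: algebra_simps)
      finally have "y * y = - ((\<sigma> * \<sigma>) *\<^sub>R (x * x))" by (simp only: scaleC_minus_left scaleR_scaleC)
      then show ?thesis using \<sigma>(2) by (simp add: power2_eq_square)
    qed
    have rem: "norm (exp z - (1 + z + (1/2) *\<^sub>R (z * z))) \<le> (\<sigma> * B) ^ 3" if z: "norm z \<le> \<sigma> * B" for z :: 'a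
    proof -
      have "norm (exp z - (\<Sum>n<3. z ^ n /\<^sub>R fact n)) \<le> exp (\<sigma> * B) / fact 3 * (\<sigma> * B) ^ 3"
        by (rule norm_exp_taylor[OF z])
      also have "\<dots> \<le> 1 * (\<sigma> * B) ^ 3"
      proof (rule mult_right_mono)
        have "exp (\<sigma> * B) \<le> 3" using s(1) exp_le order_trans exp_le_cancel_iff by blast
        then show "exp (\<sigma> * B) / fact 3 \<le> 1" by (simp add: fact_numeral)
      qed (use \<sigma> B in simp)
      finally show ?thesis by (simp add: numeral_3_eq_3 power2_eq_square fact_numeral)
    qed
    have e1: "norm (exp y) \<le> 1" "norm (exp (- y)) \<le> 1"
      using norm_exp_imaginary[of "\<sigma> *\<^sub>R x"] norm_exp_imaginary[of "- (\<sigma> *\<^sub>R x)"] assms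
      by (simp_all add: y_def star_scaleR star_uminus scaleC_minus_right)
    have eq: "1 + t *\<^sub>R - (x * x) = (1/2) *\<^sub>R (exp y + exp (- y))
       - (1/2) *\<^sub>R ((exp y - (1 + y + (1/2) *\<^sub>R (y * y))) + (exp (- y) - (1 + (- y) + (1/2) *\<^sub>R ((- y) * (- y)))))"
      unfolding minus_mult_minus yy by (simp add: algebra_simps flip: scaleR_2)
    have "norm (1 + t *\<^sub>R - (x * x)) \<le> norm ((1/2) *\<^sub>R (exp y + exp (- y)))
       + norm ((1/2) *\<^sub>R ((exp y - (1 + y + (1/2) *\<^sub>R (y * y))) + (exp (- y) - (1 + (- y) + (1/2) *\<^sub>R ((- y) * (- y))))))"
      unfolding eq by (rule norm_triangle_ineq4)
    also have "norm ((1/2) *\<^sub>R (exp y + exp (- y))) \<le> 1"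
      using e1 norm_triangle_ineq[of "exp y" "exp (- y)"] by simp
    also have "norm ((1/2) *\<^sub>R ((exp y - (1 + y + (1/2) *\<^sub>R (y * y))) + (exp (- y) - (1 + (- y) + (1/2) *\<^sub>R ((- y) * (- y))))))
       \<le> (\<sigma> * B) ^ 3"
      using rem[of y] rem[of "- y"] ny norm_triangle_ineq[of "exp y - (1 + y + (1/2) *\<^sub>R (y * y))" "exp (- y) - (1 + (- y) + (1/2) *\<^sub>R ((- y) * (- y)))"]
      unfolding norm_scaleR norm_minus_cancel by simp
    also have "(\<sigma> * B) ^ 3 = (2 * \<sigma> * B ^ 3) * t"
      using \<sigma>(2) by (simp add: power_mult_distrib power3_eq_cube power2_eq_square)
    also have "\<dots> \<le> \<epsilon> * t" using s(2) t by (intro mult_right_mono) auto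
    finally show ?thesis by simp
  qed
  then show "\<exists>d>0. \<forall>t. 0 < t \<and> t \<le> d \<longrightarrow> norm (1 + t *\<^sub>R - (x * x)) \<le> 1 + (0 + \<epsilon>) * t"
    using d by blast
qed

text \<open>For a multiple \<open>y\<close> of \<open>k\<close>, the order bounds control
  \<open>exp y\<close> and \<open>exp (- y)\<close>, and unitarity controls the exponentials of \<i>
  y and -\<i> y. In 2 sinh y + 2 sin y = 4 y + O(y^5) the cubic terms cancel, and at
  \<open>norm y = 3 / 2\<close> the left side is too small: 6 would be at most 5.72.\<close>

lemma nle_imp_norm_le:
  fixes k :: "'a::unital_cstar_algebra"
  assumes "star k = k" "nle k \<mu>" "nle (- k) \<mu>" "\<mu> < \<nu>"
  shows "norm k \<le> 10 * \<nu>"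
proof (rule ccontr)
  assume "\<not> norm k \<le> 10 * \<nu>"
  then have less: "10 * \<nu> < norm k" by simp
  have n0: "0 < norm k"
  proof (rule ccontr)
    assume "\<not> 0 < norm k"
    then have k: "k = 0" by simp
    obtain d where "0 < d" "\<And>t. 0 < t \<Longrightarrow> t \<le> d \<Longrightarrow> norm (1 + t *\<^sub>R k) \<le> 1 + \<nu> * t"
      using nleD[OF assms(2,4)] by metis
    then have "0 \<le> \<nu> * d" using k by force
    then have "0 \<le> \<nu>" using \<open>0 < d\<close> by (simp add: zero_le_mult_iff)
    then show False using less k by simp
  qed
  \<comment> \<open>This scales \<open>k\<close> to norm 3/2; the assumption
    \<open>10 * \<nu> < norm k\<close> then yields \<open>\<nu> * r \<le> 3 / 20\<close>, which
    keeps the real exponentials below 12/10.\<close>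
  define r where "r = 3 / 2 / norm k"
  have r: "0 < r" "r * norm k = 3 / 2" using n0 by (auto simp: r_def)
  define y where "y = r *\<^sub>R k"
  have ny: "norm y = 3 / 2" using r by (simp add: y_def)
  have "\<nu> * r \<le> 3 / 20" using less n0 by (simp add: r_def field_simps)
  then have "exp (\<nu> * r) \<le> exp (3 / 20 :: real)" by simp
  also have "\<dots> \<le> 12 / 10" using exp_bound[of "3 / 20"] by (simp add: power2_eq_square)
  finally have E: "exp (\<nu> * r) \<le> 12 / 10" .
  have 1: "norm (exp y) \<le> 12 / 10" "norm (exp (- y)) \<le> 12 / 10"
    using norm_exp_nle[OF assms(2,4), of r] norm_exp_nle[OF assms(3,4), of r] E r
    by (simp_all add: y_def)
  define z where "z = \<i> *\<^sub>C y"
  have sy: "star y = y" using assms(1) by (simp add: y_def star_scaleR)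
  have 2: "norm (exp z) \<le> 1" "norm (exp (- z)) \<le> 1"
    using norm_exp_imaginary[of y] norm_exp_imaginary[of "- y"] sy
    by (simp_all add: z_def star_uminus scaleC_minus_right)
  have "exp (3 / 2 :: real) ^ 2 = exp 3" by (simp flip: exp_of_nat_mult)
  also have "\<dots> = exp 1 ^ 3" by (simp flip: exp_of_nat_mult)
  also have "\<dots> \<le> 3 ^ 3" by (intro power_mono exp_le) simp
  also have "\<dots> \<le> (52 / 10)\<^sup>2" by (simp add: power2_eq_square)
  finally have e15: "exp (3 / 2 :: real) \<le> 52 / 10" using power2_le_imp_le by force
  have rem: "norm (exp w - (\<Sum>n<5. w ^ n /\<^sub>R fact n)) \<le> 33 / 100" if "norm w \<le> 3 / 2" for w :: 'a
  proof -
    have "norm (exp w - (\<Sum>n<5. w ^ n /\<^sub>R fact n)) \<le> exp (3/2) / fact 5 * (3/2) ^ 5"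
      by (rule norm_exp_taylor[OF that])
    also have "\<dots> \<le> 33 / 100" using e15 by (simp add: fact_numeral power_divide)
    finally show ?thesis .
  qed
  define Q where "Q w = exp w - (\<Sum>n<5. w ^ n /\<^sub>R fact n)" for w :: 'a
  have zz: "z * z = - (y * y)" by (simp add: z_def mult_scaleC_left mult_scaleC_right scaleC_scaleC scaleC_minus_left scaleC_one)
  have iz: "\<i> *\<^sub>C z = - y" "\<i> *\<^sub>C (z * w) = - (y * w)" for w by (simp_all add: z_def scaleC_scaleC scaleC_minus_left scaleC_one mult_scaleC_left)
  have pol: "(\<Sum>n<5. w ^ n /\<^sub>R fact n) - (\<Sum>n<5. (- w) ^ n /\<^sub>R fact n) = 2 *\<^sub>R w + (1/3) *\<^sub>R (w * w * w)" for w :: 'a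
    by (simp add: eval_nat_numeral algebra_simps flip: scaleR_2)
  \<comment> \<open>\<open>Q\<close> collects the terms of degree 5 and higher. Multiplying the odd
    part at \<open>z\<close> by \<i> reverses the sign of the linear term relative to the cubic one,
    so subtracting it doubles the former and cancels the latter.\<close>
  have eq: "4 *\<^sub>R y = (exp y - exp (- y)) - \<i> *\<^sub>C (exp z - exp (- z)) - (Q y - Q (- y)) + \<i> *\<^sub>C (Q z - Q (- z))"
  proof -
    have "(exp y - exp (- y)) - (Q y - Q (- y)) = 2 *\<^sub>R y + (1/3) *\<^sub>R (y * y * y)"
      using pol[of y] by (simp add: Q_def algebra_simps)
    moreover have "(exp z - exp (- z)) - (Q z - Q (- z)) = 2 *\<^sub>R z + (1/3) *\<^sub>R (z * z * z)"
      using pol[of z] by (simp add: Q_def algebra_simps)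
    moreover have "\<i> *\<^sub>C (2 *\<^sub>R z + (1/3) *\<^sub>R (z * z * z)) = - 2 *\<^sub>R y + (1/3) *\<^sub>R (y * y * y)"
    proof -
      have c: "\<i> *\<^sub>C (a *\<^sub>R w) = a *\<^sub>R (\<i> *\<^sub>C w)" for a :: real and w :: 'a
        by (simp add: scaleR_scaleC scaleC_scaleC mult.commute)
      have "z * z * z = - (\<i> *\<^sub>C (y * y * y))" unfolding zz by (simp add: z_def mult_scaleC_right scaleC_minus_right)
      then show ?thesis
        by (simp add: scaleC_add_right scaleC_diff_right c iz scaleC_minus_right scaleC_scaleC scaleC_minus_left scaleC_one)
    qed
    ultimately have "(exp y - exp (- y)) - (Q y - Q (- y)) - \<i> *\<^sub>C ((exp z - exp (- z)) - (Q z - Q (- z)))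
        = (2 *\<^sub>R y + (1/3) *\<^sub>R (y * y * y)) - (- 2 *\<^sub>R y + (1/3) *\<^sub>R (y * y * y))"
      by (simp only:)
    also have "\<dots> = 4 *\<^sub>R y"
      by (simp flip: scaleR_left_distrib)
    finally have "(exp y - exp (- y)) - (Q y - Q (- y)) - \<i> *\<^sub>C ((exp z - exp (- z)) - (Q z - Q (- z))) = 4 *\<^sub>R y" .
    moreover have "\<i> *\<^sub>C ((exp z - exp (- z)) - (Q z - Q (- z))) = \<i> *\<^sub>C (exp z - exp (- z)) - \<i> *\<^sub>C (Q z - Q (- z))"
      by (rule scaleC_diff_right)
    ultimately show ?thesis by (simp add: algebra_simps)
  qed
  have Qb: "norm (Q y) \<le> 33/100" "norm (Q (- y)) \<le> 33/100" "norm (Q z) \<le> 33/100" "norm (Q (- z)) \<le> 33/100"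
    using rem ny by (simp_all add: Q_def z_def norm_scaleC)
  have "norm (4 *\<^sub>R y) \<le> norm (exp y - exp (- y)) + norm (exp z - exp (- z)) + norm (Q y - Q (- y)) + norm (Q z - Q (- z))"
    unfolding eq
    by (rule order_trans[OF norm_triangle_ineq] order_trans[OF norm_triangle_ineq4] add_mono order_refl | simp add: norm_scaleC)+
  also have "\<dots> \<le> (12/10 + 12/10) + (1 + 1) + (33/100 + 33/100) + (33/100 + 33/100)"
    by (intro add_mono order_trans[OF norm_triangle_ineq4]) (use 1 2 Qb in auto)
  finally show False using ny by simp
qed

lemma nle_minus_const:
  fixes k :: "'a::real_normed_algebra_1"
  assumes "norm k \<le> c"
  shows "nle (k + (- c) *\<^sub>R 1) 0"
proof -
  have c: "0 \<le> c" using assms norm_ge_zero order_trans by blast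
  show ?thesis
    unfolding nle_def
  proof (intro allI impI exI[of _ "1 / (c + 1)"] conjI)
    fix \<epsilon> t :: real assume e: "0 < \<epsilon>" and t: "0 < t \<and> t \<le> 1 / (c + 1)"
    then have "t * (c + 1) \<le> 1" using c by (simp add: pos_le_divide_eq)
    then have tc: "t * c \<le> 1" using t by (simp add: algebra_simps)
    \<comment> \<open>As long as \<open>t * c \<le> 1\<close> both coefficients are nonnegative, and
      the two norms add up to at most 1.\<close>
    have "1 + t *\<^sub>R (k + (- c) *\<^sub>R 1) = (1 - t * c) *\<^sub>R 1 + t *\<^sub>R k" by (simp add: algebra_simps)
    then have "norm (1 + t *\<^sub>R (k + (- c) *\<^sub>R 1)) \<le> norm ((1 - t * c) *\<^sub>R (1::'a)) + norm (t *\<^sub>R k)"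
      by (metis norm_triangle_ineq)
    also have "\<dots> \<le> (1 - t * c) + t * c"
      using t tc assms by (intro add_mono) (auto intro: mult_left_mono)
    also have "\<dots> \<le> 1 + (0 + \<epsilon>) * t" using e t by simp
    finally show "norm (1 + t *\<^sub>R (k + (- c) *\<^sub>R 1)) \<le> 1 + (0 + \<epsilon>) * t" .
  qed (use c in simp)
qed

section \<open>The binomial series for inverse square roots\<close>

text \<open>The Taylor coefficients of (1 - x)^(-1/2); the sign factor makes them all
  nonnegative.\<close>

definition inv_sqrt_coeff :: "nat \<Rightarrow> real" where
  "inv_sqrt_coeff n = (-1) ^ n * ((- 1 / 2) gchoose n)"

text \<open>For \<open>norm q < 1\<close> this is (1 - q)^(-1/2), not an inverse root of
  \<open>q\<close> itself.\<close>

definition inv_sqrt :: "'a::{real_normed_algebra_1,banach} \<Rightarrow> 'a" where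
  "inv_sqrt q = suminf (\<lambda>n. inv_sqrt_coeff n *\<^sub>R q ^ n)"

lemma inv_sqrt_coeff_Suc:
  "inv_sqrt_coeff (Suc n) = inv_sqrt_coeff n * ((2 * real n + 1) / (2 * real n + 2))"
proof -
  define g where "g = ((- 1 / 2 :: real) gchoose n)"
  define g' where "g' = ((- 1 / 2 :: real) gchoose Suc n)"
  have "- 1 / 2 * g = real n * g + real (Suc n) * g'"
    unfolding g_def g'_def by (rule gbinomial_mult_1)
  then have "- g' = g * ((2 * real n + 1) / (2 * real n + 2))" by (simp add: field_simps)
  then have "(-1) ^ n * - g' = (-1) ^ n * (g * ((2 * real n + 1) / (2 * real n + 2)))" by simp
  then show ?thesis by (simp add: inv_sqrt_coeff_def g_def g'_def)
qed

lemma inv_sqrt_coeff_bounds: "0 \<le> inv_sqrt_coeff n" "inv_sqrt_coeff n \<le> 1"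
proof -
  have "0 \<le> inv_sqrt_coeff n \<and> inv_sqrt_coeff n \<le> 1"
  proof (induction n)
    case 0
    then show ?case by (simp add: inv_sqrt_coeff_def)
  next
    case (Suc n)
    then show ?case unfolding inv_sqrt_coeff_Suc
      using mult_le_one[of "inv_sqrt_coeff n" "(2 * real n + 1) / (2 * real n + 2)"] by simp
  qed
  then show "0 \<le> inv_sqrt_coeff n" "inv_sqrt_coeff n \<le> 1" by auto
qed

text \<open>The square of (1 - x)^(-1/2) is the geometric series; in coefficients this is the
  Vandermonde identity for -1/2 - 1/2 = -1.\<close>

lemma inv_sqrt_coeff_convolution: "(\<Sum>i\<le>n. inv_sqrt_coeff i * inv_sqrt_coeff (n - i)) = 1"
proof -
  have "inv_sqrt_coeff i * inv_sqrt_coeff (n - i) = (-1) ^ n * (((- 1 / 2) gchoose i) * ((- 1 / 2) gchoose (n - i)))"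
    if "i \<le> n" for i
  proof -
    have "(-1 :: real) ^ i * (-1) ^ (n - i) = (-1) ^ n" using that by (simp flip: power_add)
    moreover have "inv_sqrt_coeff i * inv_sqrt_coeff (n - i)
        = ((-1) ^ i * (-1) ^ (n - i)) * (((- 1 / 2) gchoose i) * ((- 1 / 2) gchoose (n - i)))"
      unfolding inv_sqrt_coeff_def by (simp only: mult_ac)
    ultimately show ?thesis by simp
  qed
  then have "(\<Sum>i\<le>n. inv_sqrt_coeff i * inv_sqrt_coeff (n - i))
      = (-1) ^ n * (\<Sum>i\<le>n. ((- 1 / 2) gchoose i) * ((- 1 / 2) gchoose (n - i)))"
    by (simp add: sum_distrib_left)
  also have "\<dots> = (-1) ^ n * ((-1) gchoose n)"
    using gbinomial_Vandermonde[of "- 1 / 2 :: real" "- 1 / 2" n] by (simp add: atLeast0AtMost)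
  also have "(-1 :: real) gchoose n = (-1) ^ n"
    using gbinomial_minus[of "1 :: real" n] binomial_gbinomial[of n n, where ?'a = real] by simp
  also have "(-1 :: real) ^ n * (-1) ^ n = 1" by (simp flip: power_mult_distrib)
  finally show ?thesis .
qed

lemma summable_inv_sqrt_norm:
  fixes q :: "'a::{real_normed_algebra_1,banach}"
  assumes "norm q < 1"
  shows "summable (\<lambda>n. norm (inv_sqrt_coeff n *\<^sub>R q ^ n))"
proof (rule summable_comparison_test[OF _ summable_geometric[of "norm q"]])
  have "norm (inv_sqrt_coeff n *\<^sub>R q ^ n) \<le> norm q ^ n" for n
    using mult_mono[OF inv_sqrt_coeff_bounds(2)[of n] norm_power_ineq[of q n]]
    by (simp add: inv_sqrt_coeff_bounds)
  then show "\<exists>N. \<forall>n\<ge>N. norm (norm (inv_sqrt_coeff n *\<^sub>R q ^ n)) \<le> norm q ^ n"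
    by (simp del: norm_scaleR)
qed (use assms in simp)

lemma inv_sqrt_sums:
  fixes q :: "'a::{real_normed_algebra_1,banach}"
  assumes "norm q < 1"
  shows "(\<lambda>n. inv_sqrt_coeff n *\<^sub>R q ^ n) sums inv_sqrt q"
  unfolding inv_sqrt_def
  by (rule summable_sums[OF summable_norm_cancel[OF summable_inv_sqrt_norm[OF assms]]])

lemma inv_sqrt_square:
  fixes q :: "'a::{real_normed_algebra_1,banach}"
  assumes "norm q < 1"
  shows "inv_sqrt q * inv_sqrt q * (1 - q) = 1" "(1 - q) * (inv_sqrt q * inv_sqrt q) = 1"
proof -
  have "(\<Sum>i\<le>n. (inv_sqrt_coeff i *\<^sub>R q ^ i) * (inv_sqrt_coeff (n - i) *\<^sub>R q ^ (n - i))) = q ^ n" for n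
  proof -
    have "(\<Sum>i\<le>n. (inv_sqrt_coeff i *\<^sub>R q ^ i) * (inv_sqrt_coeff (n - i) *\<^sub>R q ^ (n - i)))
        = (\<Sum>i\<le>n. (inv_sqrt_coeff i * inv_sqrt_coeff (n - i)) *\<^sub>R q ^ n)"
      by (rule sum.cong) (simp_all add: mult_ac flip: power_add)
    then show ?thesis by (simp add: inv_sqrt_coeff_convolution flip: scaleR_sum_left)
  qed
  then have s: "(\<lambda>n. q ^ n) sums (inv_sqrt q * inv_sqrt q)"
    using Cauchy_product_sums[OF summable_inv_sqrt_norm[OF assms] summable_inv_sqrt_norm[OF assms]]
    by (simp add: inv_sqrt_def)
  have "(\<lambda>n. q ^ n) \<longlonglongrightarrow> 0" by (rule LIMSEQ_power_zero[OF assms])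
  then have t: "(\<lambda>n. q ^ n - q ^ Suc n) sums 1"
    using telescope_sums'[of "\<lambda>n. q ^ n" 0] by simp
  have "(\<lambda>n. q ^ n * (1 - q)) sums (inv_sqrt q * inv_sqrt q * (1 - q))" by (rule sums_mult2[OF s])
  moreover have "q ^ n * (1 - q) = q ^ n - q ^ Suc n" for n by (simp add: algebra_simps power_commutes)
  ultimately show "inv_sqrt q * inv_sqrt q * (1 - q) = 1" using t sums_unique2 by auto
  have "(\<lambda>n. (1 - q) * q ^ n) sums ((1 - q) * (inv_sqrt q * inv_sqrt q))" by (rule sums_mult[OF s])
  moreover have "(1 - q) * q ^ n = q ^ n - q ^ Suc n" for n by (simp add: algebra_simps)
  ultimately show "(1 - q) * (inv_sqrt q * inv_sqrt q) = 1" using t sums_unique2 by auto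
qed

text \<open>Covers both \<open>B\<close> and the commutant of a single element, so that one closure
  argument shows that roots lie in \<open>B\<close> and commute with whatever commutes with the
  given element.\<close>

definition closed_real_subalgebra :: "'a::real_normed_algebra_1 set \<Rightarrow> bool" where
  "closed_real_subalgebra S \<longleftrightarrow> closed S \<and> 1 \<in> S \<and>
    (\<forall>x\<in>S. \<forall>y\<in>S. x + y \<in> S \<and> x * y \<in> S) \<and> (\<forall>r. \<forall>x\<in>S. r *\<^sub>R x \<in> S)"

lemma closed_real_subalgebra_commutant: "closed_real_subalgebra {k. x * k = k * x}"
  unfolding closed_real_subalgebra_def
proof (intro conjI)
  show "closed {k. x * k = k * x}" by (intro closed_Collect_eq continuous_intros)
  have "x * (k * l) = k * l * x" if "x * k = k * x" "x * l = l * x" for k l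
    using that by (metis mult.assoc)
  then show "\<forall>k\<in>{k. x * k = k * x}. \<forall>l\<in>{k. x * k = k * x}.
      k + l \<in> {k. x * k = k * x} \<and> k * l \<in> {k. x * k = k * x}"
    by (simp add: distrib_left distrib_right)
qed auto

lemma inv_sqrt_mem:
  assumes "closed_real_subalgebra S" "q \<in> S" "norm q < 1"
  shows "inv_sqrt q \<in> S"
proof -
  have S: "closed S" "1 \<in> S" "\<And>x y. x \<in> S \<Longrightarrow> y \<in> S \<Longrightarrow> x + y \<in> S \<and> x * y \<in> S" "\<And>r x. x \<in> S \<Longrightarrow> r *\<^sub>R x \<in> S"
    using assms(1) unfolding closed_real_subalgebra_def by auto
  have p: "q ^ n \<in> S" for n by (induction n) (use S assms(2) in auto)
  have z: "0 \<in> S" using S(4)[OF S(2), of 0] by simp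
  have "(\<Sum>i<n. inv_sqrt_coeff i *\<^sub>R q ^ i) \<in> S" for n
    by (induction n) (use S p z in auto)
  then show ?thesis
    using closed_sequentially[OF S(1), of "\<lambda>n. \<Sum>i<n. inv_sqrt_coeff i *\<^sub>R q ^ i"] inv_sqrt_sums[OF assms(3)]
    unfolding sums_def by blast
qed

lemma star_inv_sqrt:
  fixes q :: "'a::unital_cstar_algebra"
  assumes "norm q < 1"
  shows "star (inv_sqrt q) = inv_sqrt (star q)"
proof -
  have "(\<lambda>n. star (inv_sqrt_coeff n *\<^sub>R q ^ n)) sums star (inv_sqrt q)"
    by (rule bounded_linear.sums[OF bounded_linear_star inv_sqrt_sums[OF assms]])
  then show ?thesis
    using inv_sqrt_sums[of "star q"] assms sums_unique2 by (fastforce simp: star_scaleR star_power)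
qed

text \<open>Positivity of \<open>p\<close> puts a positive multiple of
  \<open>p + \<delta> *\<^sub>R 1\<close> at distance less than 1 from the unit, where the binomial
  series converges.\<close>

lemma inverse_sqrt_exists:
  fixes p :: "'a::unital_cstar_algebra"
  assumes "star p = p" "nle (- p) 0" "0 < \<delta>"
  obtains k where "star k = k" "k * k * (p + \<delta> *\<^sub>R 1) = 1"
    "\<And>S. closed_real_subalgebra S \<Longrightarrow> p \<in> S \<Longrightarrow> k \<in> S"
proof -
  obtain t where t: "0 < t" "norm (1 + t *\<^sub>R - p) \<le> 1 + \<delta> / 2 * t"
    using nleD[OF assms(2), of "\<delta> / 2"] assms(3) by (metis half_gt_zero order_refl)
  \<comment> \<open>With this \<open>s\<close>, \<open>q\<close> is \<open>1 - t *\<^sub>R p\<close>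
    divided by \<open>1 + t * \<delta>\<close>; the numerator has norm at most
    \<open>1 + \<delta> / 2 * t\<close>, which leaves \<open>norm q < 1\<close>.\<close>
  define s where "s = t / (1 + t * \<delta>)"
  have td: "0 < t * \<delta>" using t assms(3) by simp
  then have s: "0 < s" using t by (simp add: s_def)
  define q where "q = 1 - s *\<^sub>R (p + \<delta> *\<^sub>R 1)"
  have "1 - s * \<delta> = 1 / (1 + t * \<delta>)" using td by (simp add: s_def field_simps)
  then have "q = (1 / (1 + t * \<delta>)) *\<^sub>R (1 + t *\<^sub>R - p)"
  proof -
    assume eq: "1 - s * \<delta> = 1 / (1 + t * \<delta>)"
    have "q = (1 - s * \<delta>) *\<^sub>R 1 - s *\<^sub>R p" by (simp add: q_def algebra_simps)
    then show ?thesis unfolding eq by (simp add: s_def scaleR_diff_right)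
  qed
  then have "norm q \<le> (1 + \<delta> / 2 * t) / (1 + t * \<delta>)"
    using t(2) td by (simp add: divide_right_mono)
  also have "\<dots> < 1" using td by (simp add: field_simps)
  finally have q: "norm q < 1" .
  have sq: "star q = q" by (simp add: q_def star_diff star_scaleR star_add assms(1))
  define k where "k = sqrt s *\<^sub>R inv_sqrt q"
  show thesis
  proof
    show "star k = k" by (simp add: k_def star_scaleR star_inv_sqrt[OF q] sq)
    have "k * k * (p + \<delta> *\<^sub>R 1) = inv_sqrt q * inv_sqrt q * (1 - q)"
      using s by (simp add: k_def q_def)
    then show "k * k * (p + \<delta> *\<^sub>R 1) = 1" by (simp add: inv_sqrt_square[OF q])
    fix S assume S: "closed_real_subalgebra S" "p \<in> S"
    have ops: "1 \<in> S" "\<And>x y. x \<in> S \<Longrightarrow> y \<in> S \<Longrightarrow> x + y \<in> S" "\<And>r x. x \<in> S \<Longrightarrow> r *\<^sub>R x \<in> S"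
      using S(1) unfolding closed_real_subalgebra_def by auto
    have "1 + (- s) *\<^sub>R (p + \<delta> *\<^sub>R 1) \<in> S" by (intro ops S(2))
    then have "q \<in> S" by (simp add: q_def)
    then show "k \<in> S" unfolding k_def by (intro ops(3) inv_sqrt_mem[OF S(1) _ q])
  qed
qed

text \<open>The root of \<open>h = p + \<delta> *\<^sub>R 1\<close> is h^(-1/2) h. Taking the
  commutant of \<open>x\<close> as the closed subalgebra gives the commutation property.\<close>

lemma sqrt_exists:
  fixes p :: "'a::unital_cstar_algebra"
  assumes "star p = p" "nle (- p) 0" "0 < \<delta>"
  obtains k where "star k = k" "k * k = p + \<delta> *\<^sub>R 1" "\<And>x. x * p = p * x \<Longrightarrow> x * k = k * x"
proof -
  obtain k where k: "star k = k" "k * k * (p + \<delta> *\<^sub>R 1) = 1"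
    "\<And>S. closed_real_subalgebra S \<Longrightarrow> p \<in> S \<Longrightarrow> k \<in> S"
    using inverse_sqrt_exists[OF assms] by blast
  define h where "h = p + \<delta> *\<^sub>R 1"
  have comm: "x * k = k * x" if "x * p = p * x" for x
    using k(3)[OF closed_real_subalgebra_commutant[of x]] that by simp
  have hk: "h * k = k * h" unfolding h_def by (rule comm) (simp add: algebra_simps)
  show thesis
  proof (rule that[of "k * h"])
    show "star (k * h) = k * h" using hk by (simp add: star_mult k(1)) (simp add: h_def star_add star_scaleR assms(1))
    have "k * h * (k * h) = k * k * h * h" using hk by (metis mult.assoc)
    then show "k * h * (k * h) = p + \<delta> *\<^sub>R 1" using k(2) by (simp add: h_def)
    show "x * (k * h) = k * h * x" if "x * p = p * x" for x
    proof -
      have "x * h = h * x" using that by (simp add: h_def algebra_simps)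
      then show ?thesis using comm[OF that] by (metis mult.assoc)
    qed
  qed
qed

section \<open>Positivity of \<open>star a * a\<close>\<close>

text \<open>Exponential growth beats linear growth. Bernoulli's inequality is itself only linear in
  the exponent, so it is squared and compared with the hypothesis at \<open>Suc n\<close>.\<close>

lemma power_bounded_imp_le_1:
  fixes r A :: real
  assumes "\<And>n. r ^ 2 ^ n \<le> 1 + A * 2 ^ n" "0 \<le> r"
  shows "r \<le> 1"
proof (rule ccontr)
  assume "\<not> r \<le> 1"
  define \<delta> where "\<delta> = r - 1"
  have d: "0 < \<delta>" using \<open>\<not> r \<le> 1\<close> by (simp add: \<delta>_def)
  obtain n :: nat where n: "real n > (1 + 2 * \<bar>A\<bar>) / \<delta>\<^sup>2" using reals_Archimedean2 by blast
  define N :: real where "N = 2 ^ n"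
  have N: "1 \<le> N" "real n < N" by (simp_all add: N_def of_nat_less_two_power)
  have "1 + N * \<delta> \<le> r ^ 2 ^ n"
    using Bernoulli_inequality[of \<delta> "2 ^ n"] d by (simp add: N_def \<delta>_def)
  then have "(N * \<delta>)\<^sup>2 \<le> (r ^ 2 ^ n)\<^sup>2" using N d by (intro power_mono) auto
  also have "\<dots> = r ^ 2 ^ Suc n" by (simp add: mult.commute flip: power_mult)
  also have "\<dots> \<le> 1 + A * 2 ^ Suc n" by (rule assms(1))
  also have "\<dots> \<le> (1 + 2 * \<bar>A\<bar>) * N"
  proof -
    have "A * N \<le> \<bar>A\<bar> * N" using N by (intro mult_right_mono) auto
    then have "1 + A * (2 * N) \<le> N + 2 * (\<bar>A\<bar> * N)" using N by linarith
    then show ?thesis by (simp add: N_def algebra_simps)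
  qed
  finally have "N * \<delta>\<^sup>2 \<le> 1 + 2 * \<bar>A\<bar>" using N by (simp add: power2_eq_square mult_ac)
  moreover have "1 + 2 * \<bar>A\<bar> < N * \<delta>\<^sup>2"
    using n N d 
    by (metis less_trans mult_strict_right_mono pos_divide_less_eq zero_less_power)
  ultimately show False by simp
qed

text \<open>
  The spectra of \<open>c\<^sup>*c\<close> and \<open>cc\<^sup>*\<close> agree away from \<open>0\<close>; here powers of \<open>1 + \<tau>cc\<^sup>*\<close>
  replace the spectrum.
\<close>

lemma norm_one_plus_swap:
  fixes c :: "'a::unital_cstar_algebra"
  assumes "norm (1 + \<tau> *\<^sub>R (star c * c)) \<le> \<beta>" "1 \<le> \<beta>"
  shows "norm (1 + \<tau> *\<^sub>R (c * star c)) \<le> \<beta>"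
proof -
  define X where "X = 1 + \<tau> *\<^sub>R (star c * c)"
  define Y where "Y = 1 + \<tau> *\<^sub>R (c * star c)"
  have YX: "Y * c = c * X" by (simp add: X_def Y_def algebra_simps)
  \<comment> \<open>Because \<open>Y * c = c * X\<close>, powers of \<open>Y\<close> reduce to a
    geometric sum in \<open>X\<close>.\<close>
  have eq: "Y ^ N = 1 + \<tau> *\<^sub>R (c * (\<Sum>j<N. X ^ j) * star c)" for N
  proof (induction N)
    case (Suc N)
    have "Y ^ Suc N = Y * Y ^ N" by simp
    also have "\<dots> = Y + \<tau> *\<^sub>R (Y * c * (\<Sum>j<N. X ^ j) * star c)"
      unfolding Suc by (simp add: algebra_simps)
    also have "Y * c * (\<Sum>j<N. X ^ j) = c * (\<Sum>j<N. X ^ Suc j)"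
      unfolding YX by (simp add: mult.assoc sum_distrib_left)
    also have "Y + \<tau> *\<^sub>R (c * (\<Sum>j<N. X ^ Suc j) * star c) = 1 + \<tau> *\<^sub>R (c * (1 + (\<Sum>j<N. X ^ Suc j)) * star c)"
      by (simp add: Y_def algebra_simps)
    also have "1 + (\<Sum>j<N. X ^ Suc j) = (\<Sum>j<Suc N. X ^ j)" by (simp add: sum.lessThan_Suc_shift del: sum.lessThan_Suc)
    finally show ?case .
  qed simp
  define A where "A = \<bar>\<tau>\<bar> * norm c * norm c"
  \<comment> \<open>The factor in front of \<open>\<beta> ^ N\<close> is linear in \<open>N\<close>,
    which \<open>power_bounded_imp_le_1\<close> tolerates.\<close>
  have bound: "norm (Y ^ N) \<le> (1 + A * N) * \<beta> ^ N" for N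
  proof -
    have "norm (\<Sum>j<N. X ^ j) \<le> (\<Sum>j<N. \<beta> ^ N)"
    proof (rule sum_norm_le)
      fix j assume "j \<in> {..<N}"
      have "norm (X ^ j) \<le> \<beta> ^ j"
        using norm_power_ineq[of X j] power_mono[of "norm X" \<beta> j] assms(1) by (simp add: X_def)
      also have "\<dots> \<le> \<beta> ^ N" using assms(2) \<open>j \<in> {..<N}\<close> by (intro power_increasing) auto
      finally show "norm (X ^ j) \<le> \<beta> ^ N" .
    qed
    then have S: "norm (\<Sum>j<N. X ^ j) \<le> N * \<beta> ^ N" by simp
    have "norm (Y ^ N) \<le> 1 + norm (\<tau> *\<^sub>R (c * (\<Sum>j<N. X ^ j) * star c))"
      unfolding eq using norm_triangle_ineq[of 1 "\<tau> *\<^sub>R (c * (\<Sum>j<N. X ^ j) * star c)"] by simp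
    also have "norm (\<tau> *\<^sub>R (c * (\<Sum>j<N. X ^ j) * star c)) \<le> \<bar>\<tau>\<bar> * (norm c * (N * \<beta> ^ N) * norm c)"
      unfolding norm_scaleR
      using assms(2)
      by (intro mult_left_mono order_trans[OF norm_mult_ineq] mult_mono order_trans[OF norm_mult_ineq] S) auto
    also have "1 + \<bar>\<tau>\<bar> * (norm c * (N * \<beta> ^ N) * norm c) \<le> (1 + A * N) * \<beta> ^ N"
      using assms(2) one_le_power[of \<beta> N] by (simp add: A_def algebra_simps)
    finally show ?thesis by simp
  qed
  have sY: "star Y = Y" by (simp add: Y_def star_add star_scaleR star_mult star_star)
  have "norm Y / \<beta> \<le> 1"
  proof (rule power_bounded_imp_le_1)
    fix n
    show "(norm Y / \<beta>) ^ 2 ^ n \<le> 1 + A * 2 ^ n"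
      using bound[of "2 ^ n"] assms(2) by (simp add: norm_selfadjoint_power[OF sY] power_divide divide_le_eq)
  qed (use assms(2) in simp)
  then show ?thesis using assms(2) by (simp add: Y_def divide_le_eq)
qed

lemma nle_swap:
  fixes c :: "'a::unital_cstar_algebra"
  assumes "nle (star c * c) \<mu>" "0 \<le> \<mu>"
  shows "nle (c * star c) \<mu>"
  unfolding nle_def
proof (intro allI impI)
  fix \<epsilon> :: real assume e: "0 < \<epsilon>"
  obtain d where d: "0 < d" "\<And>t. 0 < t \<Longrightarrow> t \<le> d \<Longrightarrow> norm (1 + t *\<^sub>R (star c * c)) \<le> 1 + (\<mu> + \<epsilon>) * t"
    using nleD[OF assms(1), of "\<mu> + \<epsilon>"] e by auto
  then show "\<exists>d>0. \<forall>t. 0 < t \<and> t \<le> d \<longrightarrow> norm (1 + t *\<^sub>R (c * star c)) \<le> 1 + (\<mu> + \<epsilon>) * t"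
    using e assms(2) by (intro exI[of _ d]) (auto intro!: norm_one_plus_swap)
qed

text \<open>\<open>x\<close> and \<open>y\<close> come from the real and imaginary parts of
  \<open>c\<close>. Squares of selfadjoint elements are already known to be positive, while
  positivity of \<open>star c * c\<close> is still to be proved.\<close>

lemma cartesian_squares:
  fixes c :: "'a::unital_cstar_algebra"
  obtains x y where "star x = x" "star y = y" "star c * c + c * star c = 2 *\<^sub>R (x * x + y * y)"
proof
  define x where "x = (1 / 2) *\<^sub>R (c + star c)"
  define y where "y = (\<i> / 2) *\<^sub>C (c - star c)"
  show "star x = x" by (simp add: x_def star_scaleR star_add star_star add.commute)
  show "star y = y"
    using scaleC_minus_right[of "\<i> / 2" "c - star c"]
    by (simp add: y_def star_scaleC star_diff star_star scaleC_minus_left)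
  have "x * x = (1 / 4) *\<^sub>R ((c + star c) * (c + star c))" by (simp add: x_def)
  moreover have "y * y = - ((1 / 4) *\<^sub>R ((c - star c) * (c - star c)))"
    by (simp add: y_def mult_scaleC_left mult_scaleC_right scaleC_scaleC scaleR_scaleC flip: scaleC_minus_left)
  moreover have "(c + star c) * (c + star c) - (c - star c) * (c - star c) = 2 *\<^sub>R (star c * c + c * star c)"
    by (simp add: algebra_simps scaleR_2)
  ultimately have "4 *\<^sub>R (x * x + y * y) = 2 *\<^sub>R (star c * c + c * star c)"
    by (simp flip: scaleR_diff_right)
  then have "(1 / 2) *\<^sub>R (4 *\<^sub>R (x * x + y * y)) = (1 / 2) *\<^sub>R (2 *\<^sub>R (star c * c + c * star c))" by simp
  then show "star c * c + c * star c = 2 *\<^sub>R (x * x + y * y)" by simp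
qed

text \<open>The upper bound 1 on \<open>star c * c\<close> passes to \<open>c * star c\<close> by
  swapping. The sum of the two is positive, so \<open>star c * c\<close> is also bounded below by
  -1, and the two-sided bound gives \<open>10 * 2\<close>.\<close>

lemma norm_le_if_complement_square:
  fixes c z :: "'a::unital_cstar_algebra"
  assumes "star z = z" "star c * c = 1 - z * z"
  shows "norm (star c * c) \<le> 20"
proof -
  have "nle (1 + - (z * z)) (1 + 0)"
    by (rule nle_add[OF nle_norm nle_square[OF assms(1)]]) simp
  then have up: "nle (star c * c) 1" by (simp add: assms(2))
  obtain x y where xy: "star x = x" "star y = y" "star c * c + c * star c = 2 *\<^sub>R (x * x + y * y)"
    by (rule cartesian_squares)
  have "nle (c * star c + 2 *\<^sub>R (- (x * x) + - (y * y))) (1 + 2 * (0 + 0))"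
    by (rule nle_add[OF nle_swap[OF up] nle_scaleR[OF nle_add[OF nle_square[OF xy(1)] nle_square[OF xy(2)]]]]) simp_all
  also have "c * star c + 2 *\<^sub>R (- (x * x) + - (y * y)) = c * star c - 2 *\<^sub>R (x * x + y * y)"
    by (simp add: scaleR_add_right scaleR_diff_right)
  also have "\<dots> = - (star c * c)"
    unfolding xy(3)[symmetric] by simp
  finally have lo: "nle (- (star c * c)) 1" by simp
  have "norm (star c * c) \<le> 10 * 2"
    by (rule nle_imp_norm_le[OF _ up lo]) (simp_all add: star_mult star_star)
  then show ?thesis by simp
qed

text \<open>
  Kelley--Vaught. If \<open>1 - w = a\<^sup>*a\<close>, then \<open>1 - w\<^sup>2 = (ak)\<^sup>*(ak)\<close> with \<open>k = (1 + w)\<^sup>1\<^sup>/\<^sup>2\<close>, so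
  inductively \<open>1 - w\<^bsup>2^n\<^esup>\<close> has the form \<open>c\<^sup>*c\<close> and is bounded uniformly in \<open>n\<close>.
\<close>

lemma norm_one_minus_star_mult_self:
  fixes a :: "'a::unital_cstar_algebra"
  assumes "norm a \<le> 1"
  shows "norm (1 - star a * a) \<le> 1"
proof -
  define w where "w = 1 - star a * a"
  have sw: "star w = w" by (simp add: w_def star_diff star_mult star_star)
  have pow: "w ^ 2 ^ Suc n = w ^ 2 ^ n * w ^ 2 ^ n" for n
    by (simp only: power_Suc[of 2] mult_2 power_add)
  \<comment> \<open>The new factor is \<open>c * k\<close>; since \<open>k\<close> commutes with
    \<open>v\<close>, its square is \<open>(1 - v) * (1 + v)\<close>.\<close>
  have step: "\<exists>c'. star c' * c' = 1 - v * v"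
    if "star c * c = 1 - v" "star k = k" "k * k = 1 + v" "v * k = k * v" for c v k :: 'a
  proof -
    have "star (c * k) * (c * k) = k * (star c * c) * k" by (simp add: star_mult that(2) mult.assoc)
    also have "\<dots> = k * (1 - v) * k" by (simp only: that(1))
    also have "\<dots> = (1 - v) * (k * k)" 
    proof -
      have "k * (1 - v) = (1 - v) * k" using that(4) by (simp add: algebra_simps)
      then show ?thesis by (simp only: mult.assoc)
    qed
    also have "\<dots> = 1 - v * v" by (simp add: that(3) algebra_simps)
    finally show ?thesis by blast
  qed
  have "\<exists>c. star c * c = 1 - w ^ 2 ^ n" for n
  proof (induction n)
    case 0
    show ?case by (auto simp: w_def)
  next
    case (Suc n)
    define v where "v = w ^ 2 ^ n"
    have sv: "star v = v" by (simp add: v_def star_power sw)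
    \<comment> \<open>For the first power this is \<open>norm a \<le> 1\<close>; all later ones are
      squares of selfadjoint elements.\<close>
    have "nle (- v) 0"
    proof (cases n)
      case 0
      have "norm (star a * a) \<le> 1" using assms by (simp add: cstar_identity power_le_one)
      from nle_minus_const[OF this] show ?thesis using 0 by (simp add: v_def w_def)
    next
      case (Suc m)
      have "v = w ^ 2 ^ m * w ^ 2 ^ m" unfolding v_def Suc by (rule pow)
      then show ?thesis using nle_square[of "w ^ 2 ^ m"] by (simp add: star_power sw)
    qed
    then obtain k where k: "star k = k" "k * k = v + 1 *\<^sub>R 1" "\<And>x. x * v = v * x \<Longrightarrow> x * k = k * x"
      using sqrt_exists[OF sv _ zero_less_one] by blast
    obtain c where c: "star c * c = 1 - v" using Suc unfolding v_def by blast
    have "k * k = 1 + v" unfolding k(2) by (simp add: add.commute)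
    then have "\<exists>c'. star c' * c' = 1 - v * v"
      by (rule step[OF c k(1) _ k(3)[OF refl]])
    then show ?case by (simp only: v_def pow)
  qed
  \<comment> \<open>Here 21 is 1 + 20. A bound on the powers of \<open>w\<close> that is uniform in
    \<open>n\<close> forces \<open>norm w \<le> 1\<close>.\<close>
  then have b: "norm (w ^ 2 ^ Suc n) \<le> 21" for n
  proof -
    obtain c where c: "star c * c = 1 - w ^ 2 ^ n * w ^ 2 ^ n"
      using \<open>\<exists>c. star c * c = 1 - w ^ 2 ^ Suc n\<close> unfolding pow by blast
    have "norm (star c * c) \<le> 20"
      by (rule norm_le_if_complement_square[OF _ c]) (simp add: star_power sw)
    moreover have "w ^ 2 ^ Suc n = 1 - star c * c" unfolding c pow by simp
    ultimately show ?thesis using norm_triangle_ineq4[of 1 "star c * c"] by simp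
  qed
  have "norm w \<le> 1"
  proof (rule power_bounded_imp_le_1)
    fix n show "norm w ^ 2 ^ n \<le> 1 + 21 * 2 ^ n"
    proof (cases n)
      case 0
      then show ?thesis using norm_triangle_ineq4[of 1 "star a * a"] assms power_le_one[of "norm a" 2]
        by (simp add: w_def cstar_identity)
    next
      case (Suc m)
      have "norm w ^ 2 ^ n \<le> 21" using b[of m] unfolding Suc norm_selfadjoint_power[OF sw] .
      also have "\<dots> \<le> 1 + 21 * 2 ^ n" using one_le_power[of "2::real" n] by linarith
      finally show ?thesis .
    qed
  qed simp
  then show ?thesis by (simp add: w_def)
qed

text \<open>For small \<open>t\<close> the element \<open>sqrt t *\<^sub>R a\<close> lies in the
  unit ball, where the preceding bound applies.\<close>

lemma nle_star_mult_self:
  fixes a :: "'a::unital_cstar_algebra"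
  shows "nle (- (star a * a)) 0"
  unfolding nle_def
proof (intro allI impI exI[of _ "1 / (1 + norm a)\<^sup>2"] conjI)
  fix \<epsilon> t :: real assume e: "0 < \<epsilon>" and t: "0 < t \<and> t \<le> 1 / (1 + norm a)\<^sup>2"
  have "0 < 1 + norm a" by (simp add: add_pos_nonneg)
  then have "t * (1 + norm a)\<^sup>2 \<le> 1" using t by (simp add: pos_le_divide_eq)
  moreover have "t * (norm a)\<^sup>2 \<le> t * (1 + norm a)\<^sup>2" using t by (intro mult_left_mono power_mono) auto
  ultimately have "t * (norm a)\<^sup>2 \<le> 1" by linarith
  then have "(sqrt t * norm a)\<^sup>2 \<le> 1\<^sup>2" using t by (simp add: power_mult_distrib)
  then have "norm (sqrt t *\<^sub>R a) \<le> 1" using power2_le_imp_le[of "sqrt t * norm a" 1] t by simp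
  from norm_one_minus_star_mult_self[OF this]
  have "norm (1 + t *\<^sub>R - (star a * a)) \<le> 1" using t by (simp add: star_scaleR)
  also have "\<dots> \<le> 1 + (0 + \<epsilon>) * t" using e t by simp
  finally show "norm (1 + t *\<^sub>R - (star a * a)) \<le> 1 + (0 + \<epsilon>) * t" .
next
  have "0 < 1 + norm a" by (simp add: add_pos_nonneg)
  then show "0 < 1 / (1 + norm a)\<^sup>2" by simp
qed

section \<open>Sums of squares and right invertible rows\<close>

text \<open>Each summand lies between 0 and the whole sum; the factor 10 is that of
  \<open>nle_imp_norm_le\<close>.\<close>

lemma norm_square_le_norm_sum:
  fixes f :: "'i \<Rightarrow> 'a::unital_cstar_algebra"
  assumes "finite I" "i \<in> I"
  shows "(norm (f i))\<^sup>2 \<le> 10 * norm (\<Sum>j\<in>I. star (f j) * f j)"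
proof -
  define q where "q = (\<Sum>j\<in>I. star (f j) * f j)"
  define k where "k = star (f i) * f i"
  have "q = k + (\<Sum>j\<in>I - {i}. star (f j) * f j)"
    unfolding q_def k_def using assms by (rule sum.remove)
  then have k: "k = q + (\<Sum>j\<in>I - {i}. - (star (f j) * f j))" by (simp add: sum_negf)
  have "nle k (norm q + 0)"
    unfolding k by (rule nle_add[OF nle_norm[OF order_refl] nle_sum_nonpos]) (rule nle_star_mult_self)
  moreover have "nle (- k) (norm q)"
  proof -
    have "nle (- k + 0) (0 + norm q)"
      unfolding k_def by (rule nle_add[OF nle_star_mult_self nle_norm]) simp
    then show ?thesis by simp
  qed
  moreover have "star k = k" by (simp add: k_def star_mult star_star)
  ultimately have "norm k \<le> 10 * \<nu>" if "norm q < \<nu>" for \<nu>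
    using nle_imp_norm_le[of k "norm q" \<nu>] that by simp
  then have "norm k / 10 \<le> \<nu>" if "norm q < \<nu>" for \<nu> using that by fastforce
  then have "norm k / 10 \<le> norm q" by (rule dense_ge)
  then show ?thesis by (simp add: k_def q_def cstar_identity)
qed

text \<open>Let h be the row \<open>x\<close> times its adjoint. Expanding the sum of squares of
  \<open>star (x j) - t *\<^sub>R r j\<close> gives h \<ge> 2t - t^2 m, where m is the sum of
  \<open>star (r j) * r j\<close>. For small \<open>t\<close> this is at least \<open>t\<close>, so
  h has an inverse square root.\<close>

lemma row_inverse_sqrt:
  fixes x r :: "'i \<Rightarrow> 'a::unital_cstar_algebra"
  assumes "(\<Sum>j\<in>I. x j * r j) = 1"
  obtains k where "star k = k" "k * k * (\<Sum>j\<in>I. x j * star (x j)) = 1"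
    "\<And>S. closed_real_subalgebra S \<Longrightarrow> (\<Sum>j\<in>I. x j * star (x j)) \<in> S \<Longrightarrow> k \<in> S"
proof -
  define h where "h = (\<Sum>j\<in>I. x j * star (x j))"
  define m where "m = (\<Sum>j\<in>I. star (r j) * r j)"
  define t where "t = 1 / (norm m + 1)"
  have "0 < norm m + 1" by (simp add: add_nonneg_pos)
  then have t: "0 < t" "t * norm m \<le> 1" by (simp_all add: t_def)
  define p where "p = h - t *\<^sub>R 1"
  have sh: "star h = h" by (simp add: h_def star_sum star_mult star_star)
  then have sp: "star p = p" by (simp add: p_def star_diff star_scaleR)
  have x1: "(\<Sum>j\<in>I. star (r j) * star (x j)) = 1"
    using arg_cong[OF assms, of star] by (simp add: star_sum star_mult)
  have "(\<Sum>j\<in>I. star (star (x j) - t *\<^sub>R r j) * (star (x j) - t *\<^sub>R r j))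
      = h - t *\<^sub>R (\<Sum>j\<in>I. x j * r j) - t *\<^sub>R (\<Sum>j\<in>I. star (r j) * star (x j)) + (t * t) *\<^sub>R m"
    unfolding h_def m_def scaleR_sum_right sum_subtractf[symmetric] sum.distrib[symmetric]
    by (rule sum.cong) (simp_all add: star_diff star_star star_scaleR algebra_simps)
  then have eq: "- p = (\<Sum>j\<in>I. - (star (star (x j) - t *\<^sub>R r j) * (star (x j) - t *\<^sub>R r j)))
      + ((t * t) *\<^sub>R m + (- t) *\<^sub>R 1)"
    unfolding assms x1 by (simp add: sum_negf p_def)
  have "nle (- p) (0 + 0)"
    unfolding eq
  proof (rule nle_add)
    show "nle (\<Sum>j\<in>I. - (star (star (x j) - t *\<^sub>R r j) * (star (x j) - t *\<^sub>R r j))) 0"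
      by (intro nle_sum_nonpos nle_star_mult_self)
    have "norm ((t * t) *\<^sub>R m) \<le> t" using mult_left_mono[OF t(2), of t] t(1) by (simp add: mult.assoc)
    then show "nle ((t * t) *\<^sub>R m + (- t) *\<^sub>R 1) 0" by (rule nle_minus_const)
  qed
  then have np: "nle (- p) 0" by simp
  obtain k where k: "star k = k" "k * k * (p + t *\<^sub>R 1) = 1"
    "\<And>S. closed_real_subalgebra S \<Longrightarrow> p \<in> S \<Longrightarrow> k \<in> S"
    using inverse_sqrt_exists[OF sp np t(1)] by blast
  show thesis
  proof (rule that[of k])
    show "k * k * (\<Sum>j\<in>I. x j * star (x j)) = 1" using k(2) by (simp add: p_def h_def)
    fix S assume S: "closed_real_subalgebra S" "(\<Sum>j\<in>I. x j * star (x j)) \<in> S"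
    then have "h + (- t) *\<^sub>R 1 \<in> S" unfolding closed_real_subalgebra_def h_def by blast
    then have "p \<in> S" by (simp add: p_def)
    then show "k \<in> S" by (rule k(3)[OF S(1)])
  qed (rule k(1))
qed

section \<open>Matrices over a C*-subalgebra\<close>

lemma unital_cstar_subalgebra_UNIV:
  "unital_cstar_subalgebra UNIV 1 (UNIV :: 'a::unital_cstar_algebra set)"
  by (simp add: unital_cstar_subalgebra_def norm_closed_in_def)

lemma unital_cstar_subalgebra_ops:
  fixes B :: "'a::unital_cstar_algebra set"
  assumes "unital_cstar_subalgebra UNIV 1 B"
  shows "0 \<in> B" "1 \<in> B" "\<And>x y. x \<in> B \<Longrightarrow> y \<in> B \<Longrightarrow> x + y \<in> B"
    "\<And>x y. x \<in> B \<Longrightarrow> y \<in> B \<Longrightarrow> x * y \<in> B" "\<And>x. x \<in> B \<Longrightarrow> - x \<in> B"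
    "\<And>x y. x \<in> B \<Longrightarrow> y \<in> B \<Longrightarrow> x - y \<in> B" "\<And>x. x \<in> B \<Longrightarrow> star x \<in> B"
    "\<And>I f. (\<And>i. i \<in> I \<Longrightarrow> f i \<in> B) \<Longrightarrow> sum f I \<in> B"
    "\<And>c x. x \<in> B \<Longrightarrow> c *\<^sub>C x \<in> B"
proof -
  note B = assms[unfolded unital_cstar_subalgebra_def]
  have s: "c *\<^sub>C x \<in> B" if "x \<in> B" for c x using B that by blast
  then show "\<And>c x. x \<in> B \<Longrightarrow> c *\<^sub>C x \<in> B" .
  show one: "1 \<in> B" using B by blast
  show z: "0 \<in> B" using s[OF one, of 0] by simp
  show add: "x + y \<in> B" if "x \<in> B" "y \<in> B" for x y using B that by blast
  show "x * y \<in> B" if "x \<in> B" "y \<in> B" for x y using B that by blast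
  show m: "- x \<in> B" if "x \<in> B" for x using s[OF that, of "-1"] by (simp add: scaleC_minus_left scaleC_one)
  show "x - y \<in> B" if "x \<in> B" "y \<in> B" for x y using add[OF that(1) m[OF that(2)]] by simp
  show "star x \<in> B" if "x \<in> B" for x using B that by blast
  show "sum f I \<in> B" if "\<And>i. i \<in> I \<Longrightarrow> f i \<in> B" for f and I :: "'i set"
    using that by (induction I rule: infinite_finite_induct) (auto simp: z add)
qed

lemma unital_cstar_subalgebra_closed_real_subalgebra:
  fixes B :: "'a::unital_cstar_algebra set"
  assumes "unital_cstar_subalgebra UNIV 1 B"
  shows "closed_real_subalgebra B"
proof -
  have "closed B"
    unfolding closed_sequential_limits
  proof (intro allI impI)
    fix f l assume a: "(\<forall>n. f n \<in> B) \<and> f \<longlonglongrightarrow> l"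
    then have "(\<lambda>n. cstar_norm (f n - l)) \<longlonglongrightarrow> 0"
      by (simp add: cstar_norm_eq tendsto_norm_zero LIM_zero)
    moreover have "norm_closed_in UNIV B" using assms by (simp add: unital_cstar_subalgebra_def)
    ultimately show "l \<in> B" using a unfolding norm_closed_in_def by blast
  qed
  then show ?thesis
    using unital_cstar_subalgebra_ops[OF assms]
    unfolding closed_real_subalgebra_def by (simp add: scaleR_scaleC)
qed

lemmas fsmat_entry = zero_fsmat.rep_eq plus_fsmat.rep_eq minus_fsmat.rep_eq uminus_fsmat.rep_eq
  scaleC_fsmat.rep_eq star_fsmat.rep_eq one_matrix.rep_eq

lemma matricesI:
  "(\<And>i j. i < n \<Longrightarrow> j < n \<Longrightarrow> entry M i j \<in> A) \<Longrightarrow> (\<And>i j. n \<le> i \<or> n \<le> j \<Longrightarrow> entry M i j = 0)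
    \<Longrightarrow> M \<in> matrices n A"
  by (auto simp: matrices_def)

lemma matrices_entry: "M \<in> matrices n A \<Longrightarrow> i < n \<Longrightarrow> j < n \<Longrightarrow> entry M i j \<in> A"
  by (simp add: matrices_def)

lemma matrices_zero: "M \<in> matrices n A \<Longrightarrow> n \<le> i \<or> n \<le> j \<Longrightarrow> entry M i j = 0"
  by (auto simp: matrices_def)

lemma matrices_UNIV: "M \<in> matrices n A \<Longrightarrow> M \<in> matrices n UNIV"
  by (simp add: matrices_def)

lemma matrices_mono:
  "M \<in> matrices n A \<Longrightarrow> n \<le> m \<Longrightarrow> 0 \<in> A \<Longrightarrow> M \<in> matrices m A"
  unfolding matrices_def by (auto, metis leI)

lemma entry_mult_left:
  fixes M N :: "'a::ring fsmat"
  shows "M \<in> matrices n A \<Longrightarrow> entry (M * N) i j = (\<Sum>k<n. entry M i k * entry N k j)"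
  by (rule entry_times_sum) (rule matrices_zero)

lemma entry_mult_right:
  fixes M N :: "'a::ring fsmat"
  shows "N \<in> matrices n A \<Longrightarrow> entry (M * N) i j = (\<Sum>k<n. entry M i k * entry N k j)"
  unfolding times_fsmat.rep_eq by (rule Sum_any_lessThan) (simp add: matrices_zero)

lemma entry_one_matrix_mult:
  fixes M :: "'a::ring_1 fsmat"
  shows "entry (one_matrix n * M) i j = (if i < n then entry M i j else 0)"
proof -
  have "one_matrix n \<in> matrices n (UNIV :: 'a set)" by (auto simp: matrices_def one_matrix.rep_eq)
  then show ?thesis
    by (simp add: entry_mult_left one_matrix.rep_eq if_distrib[of "\<lambda>x. x * _"] cong: if_cong)
qed

lemma entry_mult_one_matrix:
  fixes M :: "'a::ring_1 fsmat"
  shows "entry (M * one_matrix n) i j = (if j < n then entry M i j else 0)"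
proof -
  have "one_matrix n \<in> matrices n (UNIV :: 'a set)" by (auto simp: matrices_def one_matrix.rep_eq)
  then show ?thesis
    by (simp add: entry_mult_right one_matrix.rep_eq if_distrib[of "\<lambda>x. _ * x"] cong: if_cong)
qed

lemma one_matrix_mult:
  fixes M :: "'a::ring_1 fsmat"
  shows "M \<in> matrices n A \<Longrightarrow> n \<le> m \<Longrightarrow> one_matrix m * M = M"
    and "M \<in> matrices n A \<Longrightarrow> n \<le> m \<Longrightarrow> M * one_matrix m = M"
  by (rule fsmat_eqI, simp add: entry_one_matrix_mult entry_mult_one_matrix matrices_zero)+

lemma star_one_matrix [simp]: "star (one_matrix n) = (one_matrix n :: 'a::unital_cstar_algebra fsmat)"
  by (rule fsmat_eqI) (auto simp: fsmat_entry)

lift_definition unit_matrix :: "nat \<Rightarrow> nat \<Rightarrow> 'a::zero \<Rightarrow> 'a fsmat"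
  is "\<lambda>i j a i' j'. if i' = i \<and> j' = j then a else 0"
proof -
  fix i j :: nat and a :: 'a
  have "{(i', j'). (if i' = i \<and> j' = j then a else 0) \<noteq> 0} \<subseteq> {(i, j)}" by auto
  then show "finite {(i', j'). (if i' = i \<and> j' = j then a else 0) \<noteq> 0}"
    by (rule finite_subset) simp
qed

lemma unit_matrix_matrices: "i < n \<Longrightarrow> j < n \<Longrightarrow> a \<in> A \<Longrightarrow> 0 \<in> A \<Longrightarrow> unit_matrix i j a \<in> matrices n A"
  by (auto simp: matrices_def unit_matrix.rep_eq)

lemma entry_unit_matrix_mult:
  fixes M :: "'a::ring fsmat"
  shows "entry (unit_matrix i j a * M) i' j' = (if i' = i then a * entry M j j' else 0)"
proof -
  have "unit_matrix i j a \<in> matrices (Suc (max i j)) UNIV"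
    by (rule unit_matrix_matrices) auto
  then show ?thesis
    by (simp add: entry_mult_left unit_matrix.rep_eq if_distrib[of "\<lambda>x. x * _"] cong: if_cong conj_cong)
qed

lemma entry_mult_unit_matrix:
  fixes M :: "'a::ring fsmat"
  shows "entry (M * unit_matrix i j a) i' j' = (if j' = j then entry M i' i * a else 0)"
proof -
  have "unit_matrix i j a \<in> matrices (Suc (max i j)) UNIV"
    by (rule unit_matrix_matrices) auto
  then show ?thesis
    by (simp add: entry_mult_right unit_matrix.rep_eq if_distrib[of "\<lambda>x. _ * x"] cong: if_cong conj_cong)
qed

lift_definition truncated_matrix :: "nat \<Rightarrow> (nat \<Rightarrow> nat \<Rightarrow> 'a) \<Rightarrow> 'a::zero fsmat"
  is "\<lambda>n f i j. if i < n \<and> j < n then f i j else 0"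
proof -
  fix n and f :: "nat \<Rightarrow> nat \<Rightarrow> 'a"
  show "finite {(i, j). (if i < n \<and> j < n then f i j else 0) \<noteq> 0}"
    unfolding finite_support_iff by (metis (mono_tags, lifting))
qed

lemma truncated_matrix_matrices:
  "(\<And>i j. i < n \<Longrightarrow> j < n \<Longrightarrow> f i j \<in> A) \<Longrightarrow> truncated_matrix n f \<in> matrices n A"
  by (auto simp: matrices_def truncated_matrix.rep_eq)

lemma matrices_ops:
  fixes B :: "'a::unital_cstar_algebra set"
  assumes B: "unital_cstar_subalgebra UNIV 1 B"
  shows "\<And>M N. M \<in> matrices n B \<Longrightarrow> N \<in> matrices n B \<Longrightarrow> M + N \<in> matrices n B"
    "\<And>M N. M \<in> matrices n B \<Longrightarrow> N \<in> matrices n B \<Longrightarrow> M - N \<in> matrices n B"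
    "\<And>M N. M \<in> matrices n B \<Longrightarrow> N \<in> matrices n B \<Longrightarrow> M * N \<in> matrices n B"
    "\<And>M. M \<in> matrices n B \<Longrightarrow> star M \<in> matrices n B"
    "\<And>c M. M \<in> matrices n B \<Longrightarrow> c *\<^sub>C M \<in> matrices n B"
    "\<And>m. m \<le> n \<Longrightarrow> one_matrix m \<in> matrices n B"
    "\<And>I F. (\<And>i. i \<in> I \<Longrightarrow> F i \<in> matrices n B) \<Longrightarrow> sum F I \<in> matrices n B"
proof -
  note ops = unital_cstar_subalgebra_ops[OF B]
  show add: "M + N \<in> matrices n B" if "M \<in> matrices n B" "N \<in> matrices n B" for M N
    using that by (auto intro!: matricesI ops simp: fsmat_entry matrices_zero dest: matrices_entry)
  show "M - N \<in> matrices n B" if "M \<in> matrices n B" "N \<in> matrices n B" for M N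
    using that by (auto intro!: matricesI ops simp: fsmat_entry matrices_zero dest: matrices_entry)
  show "M * N \<in> matrices n B" if M: "M \<in> matrices n B" and N: "N \<in> matrices n B" for M N
    using M N by (auto intro!: matricesI ops matrices_entry[OF M] matrices_entry[OF N]
        simp: entry_mult_left[OF M] matrices_zero)
  show "star M \<in> matrices n B" if "M \<in> matrices n B" for M
    using that by (auto intro!: matricesI ops simp: fsmat_entry matrices_zero dest: matrices_entry)
  show "c *\<^sub>C M \<in> matrices n B" if "M \<in> matrices n B" for c M
    using that by (auto intro!: matricesI ops simp: fsmat_entry matrices_zero dest: matrices_entry)
  show "one_matrix m \<in> matrices n B" if "m \<le> n" for m
    using that by (auto intro!: matricesI ops simp: fsmat_entry)
  have "0 \<in> matrices n B" by (auto intro!: matricesI ops simp: fsmat_entry)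
  then show "sum F I \<in> matrices n B" if "\<And>i. i \<in> I \<Longrightarrow> F i \<in> matrices n B" for F and I :: "'i set"
    using that by (induction I rule: infinite_finite_induct) (auto simp: add)
qed

subsection \<open>Norms of matrices\<close>

text \<open>Elementarily submultiplicative and bounded by a multiple of \<open>cstar_norm\<close>,
  so the perturbation estimates for matrices are carried out with it.\<close>

definition entry_sum_norm :: "nat \<Rightarrow> 'a::real_normed_vector fsmat \<Rightarrow> real" where
  "entry_sum_norm n M = (\<Sum>i<n. \<Sum>j<n. norm (entry M i j))"

lemma entry_sum_norm_nonneg: "0 \<le> entry_sum_norm n M"
  by (simp add: entry_sum_norm_def sum_nonneg)

lemma norm_entry_le_sum:
  assumes "M \<in> matrices n A"
  shows "norm (entry M i j) \<le> entry_sum_norm n M"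
proof (cases "i < n \<and> j < n")
  case True
  have "norm (entry M i j) \<le> (\<Sum>j<n. norm (entry M i j))"
    using True by (intro member_le_sum) auto
  also have "\<dots> \<le> entry_sum_norm n M" unfolding entry_sum_norm_def
    using True by (intro member_le_sum[of i "{..<n}" "\<lambda>i. \<Sum>j<n. norm (entry M i j)"]) (auto simp: sum_nonneg)
  finally show ?thesis .
next
  case False
  then show ?thesis using assms by (simp add: matrices_zero not_less entry_sum_norm_nonneg)
qed

lemma entry_sum_norm_mult:
  fixes M N :: "'a::real_normed_algebra fsmat"
  assumes "M \<in> matrices n A" "N \<in> matrices n A'"
  shows "entry_sum_norm n (M * N) \<le> entry_sum_norm n M * entry_sum_norm n N"
proof -
  define b where "b k = (\<Sum>j<n. norm (entry N k j))" for k
  have b: "0 \<le> b k" for k by (simp add: b_def sum_nonneg)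
  have bN: "b k \<le> entry_sum_norm n N" if "k < n" for k
    unfolding entry_sum_norm_def b_def[symmetric] using that b by (intro member_le_sum) auto
  have "entry_sum_norm n (M * N) \<le> (\<Sum>i<n. \<Sum>j<n. \<Sum>k<n. norm (entry M i k) * norm (entry N k j))"
    unfolding entry_sum_norm_def entry_mult_left[OF assms(1)]
    by (intro sum_mono sum_norm_le norm_mult_ineq)
  also have "\<dots> = (\<Sum>i<n. \<Sum>k<n. norm (entry M i k) * b k)"
    unfolding b_def sum_distrib_left by (intro sum.cong refl sum.swap)
  also have "\<dots> \<le> (\<Sum>i<n. \<Sum>k<n. norm (entry M i k) * entry_sum_norm n N)"
    using bN by (intro sum_mono mult_left_mono) auto
  also have "\<dots> = entry_sum_norm n M * entry_sum_norm n N"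
    by (simp add: entry_sum_norm_def sum_distrib_right)
  finally show ?thesis .
qed

text \<open>The Neumann series, summed entry by entry.\<close>

lemma matrix_right_inverse_near_one:
  fixes M :: "'a::unital_cstar_algebra fsmat"
  assumes M: "M \<in> matrices n UNIV" and small: "entry_sum_norm n M < 1"
  obtains X where "X \<in> matrices n UNIV" "(one_matrix n - M) * X = one_matrix n"
proof -
  note ops = matrices_ops[OF unital_cstar_subalgebra_UNIV[where 'a = 'a], where n = n]
  \<comment> \<open>The ambient matrix ring has no unit, so powers are iterated products that start
    at \<open>one_matrix n\<close>.\<close>
  define P where "P m = ((*) M ^^ m) (one_matrix n)" for m
  have P: "P m \<in> matrices n UNIV" for m
    by (induction m) (auto simp: P_def intro!: ops M)
  have PS: "P (Suc m) = M * P m" for m by (simp add: P_def)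
  define C where "C = entry_sum_norm n (one_matrix n :: 'a fsmat)"
  have bound: "entry_sum_norm n (P m) \<le> C * entry_sum_norm n M ^ m" for m
  proof (induction m)
    case 0
    then show ?case by (simp add: P_def C_def)
  next
    case (Suc m)
    have "entry_sum_norm n (P (Suc m)) \<le> entry_sum_norm n M * entry_sum_norm n (P m)"
      unfolding PS by (rule entry_sum_norm_mult[OF M P])
    also have "\<dots> \<le> entry_sum_norm n M * (C * entry_sum_norm n M ^ m)"
      by (intro mult_left_mono Suc entry_sum_norm_nonneg)
    finally show ?case by (simp add: mult_ac)
  qed
  have summ: "summable (\<lambda>m. entry (P m) i j)" for i j
  proof (rule summable_comparison_test[of _ "\<lambda>m. C * entry_sum_norm n M ^ m"])
    show "\<exists>N. \<forall>m\<ge>N. norm (entry (P m) i j) \<le> C * entry_sum_norm n M ^ m"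
      using norm_entry_le_sum[OF P] bound order_trans by blast
    show "summable (\<lambda>m. C * entry_sum_norm n M ^ m)"
      using small by (intro summable_mult summable_geometric) (simp add: entry_sum_norm_nonneg)
  qed
  define X where "X = truncated_matrix n (\<lambda>i j. suminf (\<lambda>m. entry (P m) i j))"
  have X: "X \<in> matrices n UNIV" unfolding X_def by (rule truncated_matrix_matrices) simp
  have sums: "(\<lambda>m. entry (P m) i j) sums entry X i j" for i j
  proof (cases "i < n \<and> j < n")
    case True
    then show ?thesis using summable_sums[OF summ[of i j]] by (simp add: X_def truncated_matrix.rep_eq)
  next
    case False
    then show ?thesis using matrices_zero[OF P] matrices_zero[OF X] by (simp add: not_less)
  qed
  have "(one_matrix n - M) * X = one_matrix n"
  proof (rule fsmat_eqI)
    fix i j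
    have "(\<lambda>m. entry (P m) i j - (\<Sum>k<n. entry M i k * entry (P m) k j)) sums
        (entry X i j - (\<Sum>k<n. entry M i k * entry X k j))"
      by (intro sums_diff sums_sum sums_mult sums)
    then have "(\<lambda>m. entry (P m) i j - entry (P (Suc m)) i j) sums entry (X - M * X) i j"
      by (simp add: PS entry_mult_left[OF M] fsmat_entry)
    moreover have "(\<lambda>m. entry (P m) i j - entry (P (Suc m)) i j) sums (entry (P 0) i j - 0)"
      by (rule telescope_sums'[OF summable_LIMSEQ_zero[OF summ]])
    ultimately have "entry (X - M * X) i j = entry (P 0) i j" using sums_unique2 by fastforce
    then show "entry ((one_matrix n - M) * X) i j = entry (one_matrix n) i j"
      by (simp add: left_diff_distrib one_matrix_mult[OF X order_refl] P_def)
  qed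
  then show thesis using X that by blast
qed

section \<open>Column norms and the operator norm\<close>

lemma column_norm_finite:
  fixes x :: "nat \<Rightarrow> 'a::unital_cstar_algebra"
  assumes "\<And>i. n \<le> i \<Longrightarrow> x i = 0"
  shows "column_norm x = sqrt (norm (\<Sum>i<n. star (x i) * x i))"
proof -
  have "Sum_any (\<lambda>i. star (x i) * x i) = (\<Sum>i<n. star (x i) * x i)"
    by (rule Sum_any_lessThan) (simp add: assms)
  then show ?thesis by (simp add: column_norm_def cstar_norm_eq)
qed

lemma norm_le_column_norm:
  fixes x :: "nat \<Rightarrow> 'a::unital_cstar_algebra"
  assumes "finite {i. x i \<noteq> 0}"
  shows "norm (x i) \<le> 4 * column_norm x"
proof (cases "x i = 0")
  case True
  then show ?thesis by (simp add: column_norm_def cstar_norm_eq)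
next
  case False
  obtain n where n: "\<forall>i\<in>{i. x i \<noteq> 0}. i < n" using assms finite_nat_set_iff_bounded by blast
  define S where "S = norm (\<Sum>i<n. star (x i) * x i)"
  have cn: "column_norm x = sqrt S"
    unfolding S_def by (rule column_norm_finite) (use n in force)
  have "(norm (x i))\<^sup>2 \<le> 10 * S"
    unfolding S_def using n False by (intro norm_square_le_norm_sum) auto
  \<comment> \<open>The constant 4 is a convenient bound for sqrt 10.\<close>
  also have "\<dots> \<le> (4 * sqrt S)\<^sup>2" by (simp add: S_def power_mult_distrib)
  finally show ?thesis unfolding cn by (rule power2_le_imp_le) (simp add: S_def)
qed

lemma column_norm_le_sum:
  fixes x :: "nat \<Rightarrow> 'a::unital_cstar_algebra"
  assumes "\<And>i. n \<le> i \<Longrightarrow> x i = 0"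
  shows "column_norm x \<le> (\<Sum>i<n. norm (x i))"
proof -
  have "norm (\<Sum>i<n. star (x i) * x i) \<le> (\<Sum>i<n. (norm (x i))\<^sup>2)"
    by (rule sum_norm_le) (simp add: cstar_identity)
  then have "column_norm x \<le> L2_set (\<lambda>i. norm (x i)) {..<n}"
    by (simp add: column_norm_finite[of n x, OF assms] L2_set_def)
  also have "\<dots> \<le> (\<Sum>i<n. norm (x i))" by (rule L2_set_le_sum) simp
  finally show ?thesis .
qed

definition mat_apply :: "'a::ring fsmat \<Rightarrow> (nat \<Rightarrow> 'a) \<Rightarrow> nat \<Rightarrow> 'a" where
  "mat_apply M x i = Sum_any (\<lambda>j. entry M i j * x j)"

lemma cstar_norm_mat_apply:
  fixes M :: "'a::unital_cstar_algebra fsmat"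
  shows "cstar_norm M = (SUP x \<in> {x. finite {j. x j \<noteq> 0} \<and> column_norm x \<le> 1}. column_norm (mat_apply M x))"
  unfolding cstar_norm_fsmat_def mat_apply_def ..

text \<open>Entries of a column in the unit ball have norm at most 4. The estimate bounds the set
  whose supremum is \<open>cstar_norm\<close>, so that values can be compared with that
  supremum.\<close>

lemma column_norm_apply_le:
  fixes M :: "'a::unital_cstar_algebra fsmat"
  assumes M: "M \<in> matrices n UNIV" and x: "finite {j. x j \<noteq> 0}" "column_norm x \<le> 1"
  shows "column_norm (mat_apply M x) \<le> 4 * entry_sum_norm n M"
proof -
  have e: "mat_apply M x i = (\<Sum>j<n. entry M i j * x j)" for i
    unfolding mat_apply_def by (rule Sum_any_lessThan) (simp add: matrices_zero[OF M])
  have nx: "norm (x j) \<le> 4" for j using norm_le_column_norm[OF x(1), of j] x(2) by simp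
  have "column_norm (mat_apply M x) \<le> (\<Sum>i<n. norm (mat_apply M x i))"
    by (rule column_norm_le_sum) (simp add: e matrices_zero[OF M])
  also have "\<dots> \<le> (\<Sum>i<n. \<Sum>j<n. norm (entry M i j) * 4)"
    unfolding e
    by (intro sum_mono sum_norm_le order_trans[OF norm_mult_ineq] mult_left_mono nx) simp
  also have "\<dots> = 4 * entry_sum_norm n M"
    by (simp add: entry_sum_norm_def sum_distrib_left mult.commute)
  finally show ?thesis .
qed

lemma bdd_above_column_norms:
  fixes M :: "'a::unital_cstar_algebra fsmat"
  assumes "M \<in> matrices n UNIV"
  shows "bdd_above ((\<lambda>x. column_norm (mat_apply M x)) ` {x. finite {j. x j \<noteq> 0} \<and> column_norm x \<le> 1})"
  using column_norm_apply_le[OF assms] by (intro bdd_aboveI2) auto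

text \<open>Apply \<open>M\<close> to the \<open>j\<close>-th basis column, which has norm
  1.\<close>

lemma norm_entry_le_cstar_norm:
  fixes M :: "'a::unital_cstar_algebra fsmat"
  assumes M: "M \<in> matrices n UNIV"
  shows "norm (entry M i j) \<le> 4 * cstar_norm M"
proof -
  define x :: "nat \<Rightarrow> 'a" where "x k = (if k = j then 1 else 0)" for k
  have fx: "finite {k. x k \<noteq> 0}" by (rule finite_subset[of _ "{j}"]) (auto simp: x_def)
  have "column_norm x = sqrt (norm (\<Sum>i<Suc j. star (x i) * x i))"
    by (rule column_norm_finite) (simp add: x_def)
  also have "(\<Sum>i<Suc j. star (x i) * x i) = 1" by (simp add: x_def)
  finally have cx: "column_norm x = 1" by simp
  have "Sum_any (\<lambda>k. entry M i k * x k) = (\<Sum>k<Suc j. entry M i k * x k)" for i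
    by (rule Sum_any_lessThan) (simp add: x_def)
  then have e: "mat_apply M x i = entry M i j" for i by (simp add: mat_apply_def x_def)
  have "{i. entry M i j \<noteq> 0} \<subseteq> {..<n}" using matrices_zero[OF M] by (auto simp: not_le[symmetric])
  then have "finite {i. mat_apply M x i \<noteq> 0}" unfolding e using finite_subset by blast
  then have "norm (entry M i j) \<le> 4 * column_norm (mat_apply M x)"
    using norm_le_column_norm[of "mat_apply M x" i] by (simp add: e)
  also have "column_norm (mat_apply M x) \<le> cstar_norm M"
    unfolding cstar_norm_mat_apply
    by (rule cSUP_upper[OF _ bdd_above_column_norms[OF M]]) (simp add: fx cx)
  finally show ?thesis by simp
qed

lemma entry_sum_norm_le_cstar_norm:
  fixes M :: "'a::unital_cstar_algebra fsmat"
  assumes "M \<in> matrices n UNIV"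
  shows "entry_sum_norm n M \<le> 4 * (real n)\<^sup>2 * cstar_norm M"
proof -
  have "entry_sum_norm n M \<le> (\<Sum>i<n. \<Sum>j<n. 4 * cstar_norm M)"
    unfolding entry_sum_norm_def by (intro sum_mono norm_entry_le_cstar_norm[OF assms])
  then show ?thesis by (simp add: power2_eq_square)
qed

text \<open>Largeness asks for an element of norm exactly 1. A positive scalar pulls out of the
  supremum, so a suitable multiple of the unit matrix is obtained without computing the norm of that
  matrix.\<close>

lemma cstar_norm_normalize:
  fixes M :: "'a::unital_cstar_algebra fsmat"
  assumes M: "M \<in> matrices n UNIV" and "M \<noteq> 0"
  obtains t where "0 < t" "cstar_norm (complex_of_real t *\<^sub>C M) = 1"
proof -
  obtain i j where "entry M i j \<noteq> 0" using assms(2) by (metis fsmat_eqI zero_fsmat.rep_eq)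
  then have c: "0 < cstar_norm M" using norm_entry_le_cstar_norm[OF M, of i j]
    by (smt (verit) zero_less_norm_iff)
  define t where "t = 1 / cstar_norm M"
  have t: "0 < t" using c by (simp add: t_def)
  define S where "S = {x :: nat \<Rightarrow> 'a. finite {j. x j \<noteq> 0} \<and> column_norm x \<le> 1}"
  have app: "column_norm (mat_apply (complex_of_real t *\<^sub>C M) x) = t * column_norm (mat_apply M x)" for x
  proof -
    have M': "complex_of_real t *\<^sub>C M \<in> matrices n UNIV"
      by (rule matrices_ops[OF unital_cstar_subalgebra_UNIV]) (rule M)
    have e: "mat_apply N x i = (\<Sum>j<n. entry N i j * x j)" if "N \<in> matrices n UNIV" for i and N :: "'a fsmat"
      unfolding mat_apply_def by (rule Sum_any_lessThan) (simp add: matrices_zero[OF that])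
    have e': "mat_apply (complex_of_real t *\<^sub>C M) x i = t *\<^sub>R mat_apply M x i" for i
      by (simp add: e[OF M] e[OF M'] fsmat_entry scaleR_sum_right flip: scaleR_scaleC)
    have z: "mat_apply M x i = 0" if "n \<le> i" for i using that by (simp add: e[OF M] matrices_zero[OF M])
    have cf: "column_norm y = sqrt (norm (\<Sum>i<n. star (y i) * y i))" if "\<And>i. n \<le> i \<Longrightarrow> y i = 0" for y :: "nat \<Rightarrow> 'a"
      using that by (rule column_norm_finite)
    have "column_norm (mat_apply (complex_of_real t *\<^sub>C M) x)
        = sqrt (norm ((t * t) *\<^sub>R (\<Sum>i<n. star (mat_apply M x i) * mat_apply M x i)))"
      by (subst cf) (simp_all add: z e' star_scaleR scaleR_sum_right)
    also have "\<dots> = t * column_norm (mat_apply M x)"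
      using t by (subst cf[of "mat_apply M x"]) (simp_all add: z real_sqrt_mult)
    finally show ?thesis .
  qed
  have "cstar_norm (complex_of_real t *\<^sub>C M) = (SUP x \<in> S. t * column_norm (mat_apply M x))"
    unfolding cstar_norm_mat_apply app S_def ..
  also have "\<dots> = 1"
  proof (rule cSup_eq_non_empty)
    have "(\<lambda>_. 0) \<in> S" by (simp add: S_def column_norm_def cstar_norm_eq)
    then show "(\<lambda>x. t * column_norm (mat_apply M x)) ` S \<noteq> {}" by blast
  next
    fix y assume "y \<in> (\<lambda>x. t * column_norm (mat_apply M x)) ` S"
    then obtain x where x: "x \<in> S" "y = t * column_norm (mat_apply M x)" by blast
    have "column_norm (mat_apply M x) \<le> cstar_norm M"
      unfolding cstar_norm_mat_apply using x(1) unfolding S_def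
      by (rule cSUP_upper[OF _ bdd_above_column_norms[OF M]])
    then show "y \<le> 1" using c x(2) by (simp add: t_def)
  next
    fix y assume y: "\<And>x. x \<in> (\<lambda>x. t * column_norm (mat_apply M x)) ` S \<Longrightarrow> x \<le> y"
    have "cstar_norm M \<le> y / t"
      unfolding cstar_norm_mat_apply S_def[symmetric]
    proof (rule cSUP_least)
      have "(\<lambda>_. 0) \<in> S" by (simp add: S_def column_norm_def cstar_norm_eq)
      then show "S \<noteq> {}" by blast
      show "column_norm (mat_apply M x) \<le> y / t" if "x \<in> S" for x
        using y[of "t * column_norm (mat_apply M x)"] that t by (simp add: pos_le_divide_eq mult.commute)
    qed
    then show "1 \<le> y" using c by (simp add: t_def)
  qed
  finally show thesis using t that by blast
qed

subsection \<open>Orthonormalization of rows\<close>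

lemma entry_mult_star:
  fixes s :: "'a::unital_cstar_algebra fsmat"
  assumes "s \<in> matrices K A"
  shows "entry (s * star s) i j = (\<Sum>c<K. entry s i c * star (entry s j c))"
  by (simp add: entry_mult_left[OF assms] fsmat_entry)

text \<open>Gram-Schmidt on the rows of \<open>w\<close>, performed by left multiplication with
  \<open>T\<close>. The right inverse \<open>R'\<close> is carried along because it guarantees that
  the next row can be normalized.\<close>

lemma orthonormal_rows:
  fixes B :: "'a::unital_cstar_algebra set"
  assumes B: "unital_cstar_subalgebra UNIV 1 B"
    and w: "w \<in> matrices K B" and R: "R \<in> matrices K UNIV" "w * R = one_matrix K"
    and "m \<le> K"
  shows "\<exists>T\<in>matrices K B. \<exists>R'\<in>matrices K UNIV. T * w * R' = one_matrix K \<and>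
    (\<forall>i<m. \<forall>j<m. entry (T * w * star (T * w)) i j = (if i = j then 1 else 0))"
  using \<open>m \<le> K\<close>
proof (induction m)
  case 0
  show ?case
  proof (rule bexI[of _ "one_matrix K"], rule bexI[of _ R])
    show "one_matrix K \<in> matrices K B" by (rule matrices_ops(6)[OF B order_refl])
  qed (use R one_matrix_mult(1)[OF w order_refl] in auto)
next
  case (Suc m)
  note E = matrices_ops[OF B, where n = K]
  note D = matrices_ops[OF unital_cstar_subalgebra_UNIV[where 'a = 'a], where n = K]
  note ops = unital_cstar_subalgebra_ops[OF B]
  have m: "m < K" using Suc.prems by simp
  obtain T R' where T: "T \<in> matrices K B" and R': "R' \<in> matrices K UNIV" "T * w * R' = one_matrix K"
    and H: "\<And>i j. i < m \<Longrightarrow> j < m \<Longrightarrow> entry (T * w * star (T * w)) i j = (if i = j then 1 else 0)"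
    using Suc by auto
  define s where "s = T * w"
  have s: "s \<in> matrices K B" unfolding s_def by (intro E T w)
  \<comment> \<open>Row \<open>m\<close> of \<open>G\<close> holds the inner products of row
    \<open>m\<close> with the earlier rows, so \<open>s - G * s\<close> subtracts the projection
    onto these. As \<open>G * G = 0\<close>, the right inverse is corrected by the factor 1 +
    G.\<close>
  define G where "G = truncated_matrix K (\<lambda>i j. if i = m \<and> j < m then entry (s * star s) i j else 0)"
  have G: "G \<in> matrices K B"
    unfolding G_def using E(3)[OF s E(4)[OF s]] ops(1)
    by (auto intro!: truncated_matrix_matrices matrices_entry)
  have GM: "entry (G * M) i j = (if i = m then (\<Sum>k<m. entry (s * star s) m k * entry M k j) else 0)" for M i j
  proof -
    have "entry (G * M) i j = (\<Sum>k<K. if i = m \<and> k < m then entry (s * star s) m k * entry M k j else 0)"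
      unfolding entry_mult_left[OF G] using m by (intro sum.cong) (auto simp: G_def truncated_matrix.rep_eq)
    also have "\<dots> = (if i = m then (\<Sum>k\<in>{..<K} \<inter> {k. k < m}. entry (s * star s) m k * entry M k j) else 0)"
      by (simp add: sum.If_cases)
    also have "{..<K} \<inter> {k. k < m} = {..<m}" using m by auto
    finally show ?thesis .
  qed
  have Gk: "entry G k j = 0" if "k < m" for k j using that by (simp add: G_def truncated_matrix.rep_eq)
  have GG: "G * G = 0"
    by (rule fsmat_eqI) (simp add: GM Gk fsmat_entry)
  define s1 where "s1 = s - G * s"
  define R1 where "R1 = R' + R' * G"
  have s1: "s1 \<in> matrices K B" unfolding s1_def by (intro E s G)
  have R1: "R1 \<in> matrices K UNIV" unfolding R1_def by (intro D R' matrices_UNIV[OF G])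
  have sR: "s * R' = one_matrix K" using R'(2) by (simp add: s_def)
  have "s1 * R1 = s * R' + s * R' * G - (G * (s * R') + G * (s * R') * G)"
    by (simp add: s1_def R1_def algebra_simps)
  also have "\<dots> = one_matrix K"
    unfolding sR by (simp add: one_matrix_mult[OF G order_refl] GG)
  finally have s1R1: "s1 * R1 = one_matrix K" .
  have row: "entry s1 i c = entry s i c" if "i \<noteq> m" for i c
    using that by (simp add: s1_def fsmat_entry GM)
  have H1a: "entry (s1 * star s1) i j = (if i = j then 1 else 0)" if "i < m" "j < m" for i j
    using H[OF that] that unfolding s_def[symmetric] entry_mult_star[OF s] entry_mult_star[OF s1] by (simp add: row)
  have H1b: "entry (s1 * star s1) m i = 0" if "i < m" for i
  proof -
    have "entry (s1 * star s1) m i = entry (s1 * star s) m i"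
      using that unfolding entry_mult_left[OF s1] by (simp add: fsmat_entry row)
    also have "s1 * star s = s * star s - G * (s * star s)"
      by (simp add: s1_def algebra_simps)
    also have "entry \<dots> m i = entry (s * star s) m i - (\<Sum>k<m. entry (s * star s) m k * (if k = i then 1 else 0))"
      using that H unfolding s_def[symmetric] by (simp add: fsmat_entry GM)
    also have "\<dots> = 0" using that by (simp add: if_distrib[of "\<lambda>x. _ * x"] cong: if_cong)
    finally show ?thesis .
  qed
  \<comment> \<open>The diagonal entry of \<open>s1 * R1\<close> shows that the new row
    \<open>m\<close> is right invertible, hence that its inner product with itself is
    invertible.\<close>
  have "(\<Sum>j<K. entry s1 m j * entry R1 j m) = 1"
    using arg_cong[OF s1R1, of "\<lambda>M. entry M m m"] m by (simp add: entry_mult_left[OF s1] fsmat_entry)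
  then obtain k where k: "star k = k" "k * k * (\<Sum>j<K. entry s1 m j * star (entry s1 m j)) = 1"
    "\<And>S. closed_real_subalgebra S \<Longrightarrow> (\<Sum>j<K. entry s1 m j * star (entry s1 m j)) \<in> S \<Longrightarrow> k \<in> S"
    using row_inverse_sqrt[of "\<lambda>j. entry s1 m j" "\<lambda>j. entry R1 j m" "{..<K}"] by blast
  define h where "h = (\<Sum>j<K. entry s1 m j * star (entry s1 m j))"
  have hB: "h \<in> B" unfolding h_def using m by (intro ops matrices_entry[OF s1]) auto
  have kB: "k \<in> B"
    using k(3)[OF unital_cstar_subalgebra_closed_real_subalgebra[OF B]] hB by (simp add: h_def)
  have sh: "star h = h" by (simp add: h_def star_sum star_mult star_star)
  have kkh: "k * k * h = 1" using k(2) by (simp add: h_def)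
  have hkk: "h * k * k = 1" using arg_cong[OF kkh, of star] by (simp add: star_mult k(1) sh mult.assoc)
  have "k * h = (h * k * k) * (k * h)" by (simp add: hkk)
  also have "\<dots> = h * k * (k * k * h)" by (simp add: mult.assoc)
  finally have kh: "k * h = h * k" by (simp add: kkh)
  have khk: "k * h * k = 1" unfolding kh by (rule hkk)
  \<comment> \<open>Left multiplication by \<open>d k\<close> normalizes row \<open>m\<close>; on
    the right it is undone by \<open>d (k * h)\<close>, because
    \<open>k * k * h = 1\<close>.\<close>
  define d where "d a = truncated_matrix K (\<lambda>i j. if i = j then (if i = m then a else 1) else 0)" for a :: 'a
  have d: "d a \<in> matrices K B" if "a \<in> B" for a
    unfolding d_def using that ops(1,2) by (auto intro!: truncated_matrix_matrices)
  have dM: "entry (d a * M) i j = (if i = m then a * entry M i j else if i < K then entry M i j else 0)" for a M i j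
  proof -
    have "d a \<in> matrices K UNIV" unfolding d_def by (rule truncated_matrix_matrices) simp
    then have "entry (d a * M) i j = (\<Sum>l<K. entry (d a) i l * entry M l j)" by (rule entry_mult_left)
    also have "\<dots> = (\<Sum>l<K. if l = i then (if i = m then a * entry M i j else entry M i j) else 0)"
      by (intro sum.cong) (auto simp: d_def truncated_matrix.rep_eq)
    finally show ?thesis using m by simp
  qed
  have dd: "d k * d (k * h) = one_matrix K"
  proof (rule fsmat_eqI)
    have "entry (d a) i j = (if i < K \<and> j = i then if i = m then a else 1 else 0)" for a i j
      by (auto simp: d_def truncated_matrix.rep_eq)
    then show "entry (d k * d (k * h)) i j = entry (one_matrix K) i j" for i j
      using kkh m by (simp add: dM fsmat_entry mult.assoc)
  qed
  define T2 where "T2 = d k * (T - G * T)"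
  define R2 where "R2 = R1 * d (k * h)"
  define s2 where "s2 = d k * s1"
  have T2: "T2 \<in> matrices K B" unfolding T2_def by (intro E d kB T G)
  have R2: "R2 \<in> matrices K UNIV" unfolding R2_def by (intro D R1 matrices_UNIV[OF d] ops kB hB)
  have s2: "s2 \<in> matrices K B" unfolding s2_def by (intro E d kB s1)
  have s2T: "T2 * w = s2" by (simp add: T2_def s2_def s1_def s_def algebra_simps)
  have "s2 * R2 = d k * (s1 * R1) * d (k * h)" by (simp add: s2_def R2_def mult.assoc)
  also have "\<dots> = one_matrix K" unfolding s1R1 one_matrix_mult(2)[OF d[OF kB] order_refl] by (rule dd)
  finally have s2R2: "s2 * R2 = one_matrix K" .
  have row2: "entry s2 i c = (if i = m then k * entry s1 i c else entry s1 i c)" if "i < K" for i c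
    using that by (simp add: s2_def dM)
  have H2a: "entry (s2 * star s2) i j = (if i = j then 1 else 0)" if "i < m" "j < m" for i j
    using H1a[OF that] that m unfolding entry_mult_star[OF s2] entry_mult_star[OF s1] by (simp add: row2)
  have H2b: "entry (s2 * star s2) m i = 0" if "i < m" for i
  proof -
    have "entry (s2 * star s2) m i = k * entry (s1 * star s1) m i"
      using that m unfolding entry_mult_star[OF s2] entry_mult_star[OF s1]
      by (simp add: row2 sum_distrib_left mult.assoc)
    then show ?thesis using H1b[OF that] by simp
  qed
  have H2c: "entry (s2 * star s2) i m = 0" if "i < m" for i
  proof -
    have "s2 * star s2 = star (s2 * star s2)" by (simp add: star_mult star_star)
    then have "entry (s2 * star s2) i m = star (entry (s2 * star s2) m i)" by (metis star_fsmat.rep_eq)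
    then show ?thesis using H2b[OF that] by simp
  qed
  have "entry (s2 * star s2) m m = k * h * k"
    using m unfolding entry_mult_star[OF s2] h_def
    by (simp add: row2 star_mult k(1) sum_distrib_left sum_distrib_right mult.assoc)
  then have H2d: "entry (s2 * star s2) m m = 1" by (simp add: khk)
  have "\<forall>i<Suc m. \<forall>j<Suc m. entry (s2 * star s2) i j = (if i = j then 1 else 0)"
    using H2a H2b H2c H2d by (auto simp: less_Suc_eq)
  then show ?case using T2 R2 s2T s2R2 by metis
qed

lemma coisometry_of_right_invertible:
  fixes B :: "'a::unital_cstar_algebra set"
  assumes B: "unital_cstar_subalgebra UNIV 1 B"
    and w: "w \<in> matrices K B" and R: "R \<in> matrices K UNIV" "w * R = one_matrix K"
  obtains T where "T \<in> matrices K B" "T * w * star (T * w) = one_matrix K"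
proof -
  obtain T where T: "T \<in> matrices K B"
    "\<And>i j. i < K \<Longrightarrow> j < K \<Longrightarrow> entry (T * w * star (T * w)) i j = (if i = j then 1 else 0)"
    using orthonormal_rows[OF B w R order_refl] by blast
  have "T * w * star (T * w) \<in> matrices K B" by (intro matrices_ops[OF B] T w)
  then have "T * w * star (T * w) = one_matrix K"
    by (intro fsmat_eqI) (use T(2) in \<open>auto simp: fsmat_entry matrices_zero not_less\<close>, metis matrices_zero not_less)
  then show thesis using T(1) that by blast
qed

section \<open>Stable finiteness\<close>

text \<open>The closed ideal generated by \<open>d\<close> is everything, so the algebraic ideal has
  an element at distance less than 1 from the unit. Such an element is invertible, which puts 1 into
  the algebraic ideal itself.\<close>

lemma simple_sum_eq_one:
  fixes d :: "'a::unital_cstar_algebra"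
  assumes "simple (UNIV :: 'a set)" "d \<noteq> 0"
  obtains m :: nat and x y where "(\<Sum>k<m. x k * d * y k) = 1"
proof -
  define I where "I = {sum_list (map (\<lambda>(x, y). x * d * y) ps) | ps. True}"
  have I_add: "z + z' \<in> I" if "z \<in> I" "z' \<in> I" for z z'
  proof -
    from that obtain ps ps' where "z = sum_list (map (\<lambda>(x, y). x * d * y) ps)"
      "z' = sum_list (map (\<lambda>(x, y). x * d * y) ps')" unfolding I_def by blast
    then have "z + z' = sum_list (map (\<lambda>(x, y). x * d * y) (ps @ ps'))" by simp
    then show ?thesis unfolding I_def by blast
  qed
  have I_left: "a * z \<in> I" if "z \<in> I" for a z
  proof -
    from that obtain ps where "z = sum_list (map (\<lambda>(x, y). x * d * y) ps)" unfolding I_def by blast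
    moreover have "a * sum_list (map (\<lambda>(x, y). x * d * y) ps)
        = sum_list (map (\<lambda>(x, y). x * d * y) (map (\<lambda>(x, y). (a * x, y)) ps))"
      by (induction ps) (auto simp: distrib_left mult.assoc)
    ultimately have "a * z = sum_list (map (\<lambda>(x, y). x * d * y) (map (\<lambda>(x, y). (a * x, y)) ps))"
      by simp
    then show ?thesis unfolding I_def by blast
  qed
  have I_right: "z * a \<in> I" if "z \<in> I" for a z
  proof -
    from that obtain ps where "z = sum_list (map (\<lambda>(x, y). x * d * y) ps)" unfolding I_def by blast
    moreover have "sum_list (map (\<lambda>(x, y). x * d * y) ps) * a
        = sum_list (map (\<lambda>(x, y). x * d * y) (map (\<lambda>(x, y). (x, y * a)) ps))"
      by (induction ps) (auto simp: distrib_right mult.assoc)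
    ultimately have "z * a = sum_list (map (\<lambda>(x, y). x * d * y) (map (\<lambda>(x, y). (x, y * a)) ps))"
      by simp
    then show ?thesis unfolding I_def by blast
  qed
  have I_d: "d \<in> I"
    unfolding I_def by (rule CollectI, rule exI[of _ "[(1, 1)]"]) simp
  have I_0: "0 \<in> I"
    unfolding I_def by (rule CollectI, rule exI[of _ "[]"]) simp
  define J where "J = closure I"
  have IJ: "I \<subseteq> J" unfolding J_def by (rule closure_subset)
  have J_lim: "z \<in> J" if "\<And>n. f n \<in> I" "f \<longlonglongrightarrow> z" for f z
    unfolding J_def closure_sequential using that by (intro exI[of _ f]) simp
  have J_seq: "\<exists>f. (\<forall>n. f n \<in> I) \<and> f \<longlonglongrightarrow> z" if "z \<in> J" for z
    using that unfolding J_def closure_sequential .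
  have J_left: "a * z \<in> J" if "z \<in> J" for a z
  proof -
    from J_seq[OF that] obtain f where f: "\<forall>n. f n \<in> I" "f \<longlonglongrightarrow> z" by auto
    have "(\<lambda>n. a * f n) \<longlonglongrightarrow> a * z" by (intro tendsto_intros f(2))
    then show ?thesis by (rule J_lim[rotated]) (use f(1) I_left in blast)
  qed
  have J_right: "z * a \<in> J" if "z \<in> J" for a z
  proof -
    from J_seq[OF that] obtain f where f: "\<forall>n. f n \<in> I" "f \<longlonglongrightarrow> z" by auto
    have "(\<lambda>n. f n * a) \<longlonglongrightarrow> z * a" by (intro tendsto_intros f(2))
    then show ?thesis by (rule J_lim[rotated]) (use f(1) I_right in blast)
  qed
  have J_add: "z + z' \<in> J" if "z \<in> J" "z' \<in> J" for z z'
  proof -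
    from J_seq[OF that(1)] obtain f where f: "\<forall>n. f n \<in> I" "f \<longlonglongrightarrow> z" by auto
    from J_seq[OF that(2)] obtain f' where f': "\<forall>n. f' n \<in> I" "f' \<longlonglongrightarrow> z'" by auto
    have "(\<lambda>n. f n + f' n) \<longlonglongrightarrow> z + z'" by (intro tendsto_intros f(2) f'(2))
    then show ?thesis by (rule J_lim[rotated]) (use f(1) f'(1) I_add in blast)
  qed
  have J_scale: "c *\<^sub>C z \<in> J" if "z \<in> J" for c z
    using J_left[OF that, of "c *\<^sub>C 1"] by (simp add: mult_scaleC_left)
  have "norm_closed_in UNIV J"
    unfolding norm_closed_in_def
  proof (intro allI impI)
    fix f :: "nat \<Rightarrow> 'a" and l
    assume a: "range f \<subseteq> J \<and> l \<in> UNIV \<and> (\<lambda>n. cstar_norm (f n - l)) \<longlonglongrightarrow> 0"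
    then have "f \<longlonglongrightarrow> l" by (simp add: cstar_norm_eq tendsto_norm_zero_iff LIM_zero_iff)
    then show "l \<in> J" using a closed_sequentially[of J f l] by (auto simp: J_def)
  qed
  then have "closed_ideal UNIV J"
    unfolding closed_ideal_def by (intro conjI ballI allI J_left J_right J_add J_scale subsetD[OF IJ I_0]) auto
  then have "J = {0} \<or> J = UNIV" using assms(1) unfolding simple_def by simp
  moreover have "J \<noteq> {0}" using subsetD[OF IJ I_d] assms(2) by auto
  ultimately have "1 \<in> closure I" unfolding J_def by simp
  then have "\<exists>z\<in>I. dist z 1 < 1" unfolding closure_approachable by simp
  then obtain z where z: "z \<in> I" "dist z 1 < 1" by blast
  \<comment> \<open>The square of \<open>inv_sqrt q\<close> inverts \<open>1 - q\<close>, which is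
    \<open>z\<close>.\<close>
  define q where "q = 1 - z"
  have "norm q < 1" using z(2) by (simp add: q_def dist_norm norm_minus_commute)
  then have "z * (inv_sqrt q * inv_sqrt q) = 1" using inv_sqrt_square(2)[of q] by (simp add: q_def)
  then have "1 \<in> I" using I_right[OF z(1), of "inv_sqrt q * inv_sqrt q"] by simp
  then obtain ps where ps: "1 = sum_list (map (\<lambda>(x, y). x * d * y) ps)" unfolding I_def by blast
  then have "(\<Sum>k<length ps. fst (ps ! k) * d * snd (ps ! k)) = 1"
    by (simp add: sum_list_sum_nth case_prod_unfold atLeast0LessThan)
  then show thesis by (rule that)
qed

lemma entry_sum: "entry (sum F I) i j = (\<Sum>a\<in>I. entry (F a) i j)"
  by (induction I rule: infinite_finite_induct) (simp_all add: fsmat_entry)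

text \<open>The wandering projections of an isometry: \<open>star s * s\<close> cancels common
  powers of \<open>s\<close>, and any power left over is killed by \<open>p * s = 0\<close> or its
  adjoint.\<close>

lemma orthogonal_copies:
  fixes s :: "'a::unital_cstar_algebra fsmat"
  assumes s: "s \<in> matrices n UNIV" "star s * s = one_matrix n"
  defines "p \<equiv> one_matrix n - s * star s"
  shows "star (((*) s ^^ q) p) * ((*) s ^^ q') p = (if q = q' then p else 0)"
proof -
  note D = matrices_ops[OF unital_cstar_subalgebra_UNIV[where 'a = 'a], where n = n]
  have p: "p \<in> matrices n UNIV" unfolding p_def by (intro D order_refl s)
  have sp: "star p = p" by (simp add: p_def star_diff star_mult star_star)
  have ps: "p * s = 0"
    by (simp add: p_def left_diff_distrib mult.assoc s(2) one_matrix_mult[OF s(1) order_refl])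
  have s_p: "star s * p = 0" using arg_cong[OF ps, of star] by (simp add: star_mult sp)
  have "p * p = p * one_matrix n - p * s * star s" by (simp add: p_def algebra_simps)
  then have pp: "p * p = p" by (simp add: ps one_matrix_mult[OF p order_refl])
  have V: "((*) s ^^ q) p \<in> matrices n UNIV" for q by (induction q) (auto intro!: D s p)
  show ?thesis
  proof (induction q arbitrary: q')
    case 0
    then show ?case by (cases q') (simp_all add: sp pp ps flip: mult.assoc)
  next
    case (Suc q)
    show ?case
    proof (cases q')
      case 0
      then show ?thesis by (simp add: star_mult mult.assoc s_p)
    next
      case (Suc r)
      have "star (((*) s ^^ Suc q) p) * ((*) s ^^ q') p
          = star (((*) s ^^ q) p) * (star s * s * ((*) s ^^ r) p)"
        by (simp add: Suc star_mult mult.assoc)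
      also have "star s * s * ((*) s ^^ r) p = ((*) s ^^ r) p"
        unfolding s(2) by (rule one_matrix_mult[OF V order_refl])
      finally show ?thesis using Suc.IH[of r] Suc by simp
    qed
  qed
qed

text \<open>
  If \<open>M\<^sub>n(A)\<close> contains a proper isometry \<open>s\<close>, then the pairwise orthogonal copies \<open>s\<^sup>qp\<close> of
  \<open>p = 1 - ss\<^sup>*\<close> in \<open>M\<^sub>n(A)\<close> suffice to dominate the unit of \<open>M\<^sub>K(A)\<close> for every \<open>K\<close>.
\<close>

lemma unit_factors_through_corner:
  fixes s :: "'a::unital_cstar_algebra fsmat"
  assumes simple: "simple (UNIV :: 'a set)"
    and s: "s \<in> matrices n UNIV" "star s * s = one_matrix n" "s * star s \<noteq> one_matrix n"
    and nK: "n \<le> K"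
  obtains L R :: "'a fsmat" where "L \<in> matrices K UNIV" "R \<in> matrices K UNIV" "L * R = one_matrix K"
    "one_matrix n * R = R"
proof -
  note Dn = matrices_ops[OF unital_cstar_subalgebra_UNIV[where 'a = 'a], where n = n]
  note D = matrices_ops[OF unital_cstar_subalgebra_UNIV[where 'a = 'a], where n = K]
  define p where "p = one_matrix n - s * star s"
  have p: "p \<in> matrices n UNIV" unfolding p_def by (intro Dn order_refl s)
  have "p \<noteq> 0" using s(3) by (simp add: p_def)
  then obtain i0 j0 where ij: "entry p i0 j0 \<noteq> 0" by (metis fsmat_eqI zero_fsmat.rep_eq)
  then have ijn: "i0 < n" "j0 < n" using matrices_zero[OF p] not_less by blast+
  obtain m :: nat and x y where xy: "(\<Sum>k<m. x k * entry p i0 j0 * y k) = 1"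
    using simple_sum_eq_one[OF simple ij] by blast
  \<comment> \<open>Encoding pairs (row, summand) as exponents gives distinct pairs orthogonal
    copies of \<open>p\<close>.\<close>
  define V where "V a = ((*) s ^^ prod_encode a) p" for a
  have V: "V a \<in> matrices n UNIV" for a
  proof -
    have "((*) s ^^ q) p \<in> matrices n UNIV" for q by (induction q) (auto intro!: Dn s p)
    then show ?thesis by (simp add: V_def)
  qed
  have VK: "V a \<in> matrices K UNIV" for a by (rule matrices_mono[OF V nK]) simp
  have VV: "star (V a) * V b = (if a = b then p else 0)" for a b
    unfolding V_def p_def orthogonal_copies[OF s(1,2)] by (simp add: inj_prod_encode[THEN inj_eq])
  define P where "P = {..<K} \<times> {..<m}"
  define U where "U a = unit_matrix (fst a) i0 (x (snd a))" for a
  define W where "W a = unit_matrix j0 (fst a) (y (snd a))" for a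
  define L where "L = (\<Sum>a\<in>P. U a * star (V a))"
  define R where "R = (\<Sum>a\<in>P. V a * W a)"
  have U: "U a \<in> matrices K UNIV" if "a \<in> P" for a
    using that ijn nK unfolding U_def P_def by (intro unit_matrix_matrices) auto
  have W: "W a \<in> matrices K UNIV" if "a \<in> P" for a
    using that ijn nK unfolding W_def P_def by (intro unit_matrix_matrices) auto
  show thesis
  proof (rule that[of L R])
    show "L \<in> matrices K UNIV" unfolding L_def by (intro D U VK)
    show "R \<in> matrices K UNIV" unfolding R_def by (intro D W VK)
    show "one_matrix n * R = R"
      unfolding R_def sum_distrib_left
      by (simp add: one_matrix_mult[OF V order_refl] flip: mult.assoc)
    \<comment> \<open>Orthogonality leaves the terms with equal indices. The term for
      \<open>(l, k)\<close> has the single entry \<open>x k * entry p i0 j0 * y k\<close> at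
      position \<open>(l, l)\<close>, and summing over \<open>k\<close> gives 1 there.\<close>
    have "L * R = (\<Sum>a\<in>P. \<Sum>b\<in>P. U a * (star (V a) * V b) * W b)"
      unfolding L_def R_def sum_product by (simp add: mult.assoc)
    also have "\<dots> = (\<Sum>a\<in>P. \<Sum>b\<in>P. if b = a then U a * p * W a else 0)"
      by (intro sum.cong refl) (auto simp: VV)
    also have "\<dots> = (\<Sum>a\<in>P. U a * p * W a)" by (simp add: P_def)
    also have "\<dots> = one_matrix K"
    proof (rule fsmat_eqI)
      fix i j
      have "entry (\<Sum>a\<in>P. U a * p * W a) i j
          = (\<Sum>(l, k)\<in>P. if i = l \<and> j = l then x k * entry p i0 j0 * y k else 0)"
        unfolding entry_sum by (intro sum.cong refl)
          (auto simp: U_def W_def entry_mult_unit_matrix entry_unit_matrix_mult)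
      also have "\<dots> = (\<Sum>l<K. \<Sum>k<m. if i = l \<and> j = l then x k * entry p i0 j0 * y k else 0)"
        unfolding P_def by (rule sum.cartesian_product[symmetric])
      also have "\<dots> = (\<Sum>l<K. if l = i then (if j = i then 1 else 0) else 0)"
        by (intro sum.cong refl) (auto simp: xy)
      also have "\<dots> = entry (one_matrix K) i j" by (auto simp: fsmat_entry)
      finally show "entry (\<Sum>a\<in>P. U a * p * W a) i j = entry (one_matrix K) i j" .
    qed
    finally show "L * R = one_matrix K" .
  qed
qed

section \<open>Positive elements for the largeness condition\<close>

lemma positive_scaleC_one_matrix:
  assumes "0 < t"
  shows "positive (matrices K (UNIV :: 'a::unital_cstar_algebra set)) (one_matrix K)
    (complex_of_real t *\<^sub>C one_matrix K)"
  unfolding positive_def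
proof (intro conjI)
  note D = matrices_ops[OF unital_cstar_subalgebra_UNIV[where 'a = 'a], where n = K]
  let ?e = "one_matrix K :: 'a fsmat"
  have e: "?e \<in> matrices K UNIV" by (rule D(6)) simp
  have ee: "?e * ?e = ?e" by (rule one_matrix_mult[OF e order_refl])
  show "complex_of_real t *\<^sub>C ?e \<in> matrices K UNIV" by (intro D e)
  show "star (complex_of_real t *\<^sub>C ?e) = complex_of_real t *\<^sub>C ?e" by (simp add: star_scaleC)
  show "spectrum (matrices K UNIV) ?e (complex_of_real t *\<^sub>C ?e) \<subseteq> \<real>\<^sub>\<ge>\<^sub>0"
  proof
    fix c assume c: "c \<in> spectrum (matrices K UNIV) ?e (complex_of_real t *\<^sub>C ?e)"
    have "c = complex_of_real t"
    proof (rule ccontr)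
      assume "c \<noteq> complex_of_real t"
      then have ne: "complex_of_real t - c \<noteq> 0" by simp
      define b where "b = (1 / (complex_of_real t - c)) *\<^sub>C ?e"
      have "complex_of_real t *\<^sub>C ?e - c *\<^sub>C ?e = (complex_of_real t - c) *\<^sub>C ?e"
        using scaleC_add_left[of "complex_of_real t - c" c ?e] by (simp add: algebra_simps)
      then have "b * (complex_of_real t *\<^sub>C ?e - c *\<^sub>C ?e) = ?e"
        "(complex_of_real t *\<^sub>C ?e - c *\<^sub>C ?e) * b = ?e"
        using ne by (simp_all add: b_def mult_scaleC_left mult_scaleC_right scaleC_scaleC ee scaleC_one)
      moreover have "b \<in> matrices K UNIV" unfolding b_def by (intro D e)
      ultimately show False using c unfolding spectrum_def by blast
    qed
    then show "c \<in> \<real>\<^sub>\<ge>\<^sub>0" using assms by simp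
  qed
qed

text \<open>The smaller unit is a projection, and the spectrum of a projection lies in {0,
  1}.\<close>

lemma positive_one_matrix:
  fixes B :: "'a::unital_cstar_algebra set"
  assumes B: "unital_cstar_subalgebra UNIV 1 B" and nK: "n \<le> K"
  shows "positive (matrices K B) (one_matrix K) (one_matrix n)"
  unfolding positive_def
proof (intro conjI)
  note E = matrices_ops[OF B, where n = K]
  let ?u = "one_matrix K :: 'a fsmat" and ?e = "one_matrix n :: 'a fsmat"
  have u: "?u \<in> matrices K B" and e: "?e \<in> matrices K B" using nK by (auto intro: E)
  show "?e \<in> matrices K B" by (rule e)
  show "star ?e = ?e" by simp
  have eu: "?u * ?u = ?u" "?u * ?e = ?e" "?e * ?u = ?e"
    using one_matrix_mult[OF u order_refl] one_matrix_mult[OF e order_refl] by auto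
  have ee: "?e * ?e = ?e" by (rule fsmat_eqI) (simp add: entry_one_matrix_mult fsmat_entry)
  show "spectrum (matrices K B) ?u ?e \<subseteq> \<real>\<^sub>\<ge>\<^sub>0"
  proof
    fix c assume c: "c \<in> spectrum (matrices K B) ?u ?e"
    have "c = 0 \<or> c = 1"
    proof (rule ccontr)
      assume "\<not> (c = 0 \<or> c = 1)"
      then have ne: "c \<noteq> 0" "1 - c \<noteq> 0" by auto
      define f where "f = ?u - ?e"
      have f: "f * f = f" "?e * f = 0" "f * ?e = 0" by (simp_all add: f_def algebra_simps eu ee)
      \<comment> \<open>On the complementary projections \<open>?e\<close> and \<open>f\<close> the
        element \<open>?e - c *\<^sub>C ?u\<close> acts as the scalars \<open>1 - c\<close> and
        \<open>- c\<close>; \<open>b\<close> inverts both.\<close>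
      define b where "b = (1 / (1 - c)) *\<^sub>C ?e + (- 1 / c) *\<^sub>C f"
      have "c *\<^sub>C ?u = c *\<^sub>C ?e + c *\<^sub>C f" by (simp add: f_def flip: scaleC_add_right)
      moreover have "?e - c *\<^sub>C ?e = (1 - c) *\<^sub>C ?e"
        using scaleC_add_left[of "1 - c" c ?e] by (simp add: algebra_simps scaleC_one)
      ultimately have a: "?e - c *\<^sub>C ?u = (1 - c) *\<^sub>C ?e + (- c) *\<^sub>C f"
        by (simp add: algebra_simps scaleC_minus_left)
      have "b * (?e - c *\<^sub>C ?u) = ?u" "(?e - c *\<^sub>C ?u) * b = ?u"
        unfolding a b_def distrib_left distrib_right using ne
        by (simp_all add: mult_scaleC_left mult_scaleC_right scaleC_scaleC ee f scaleC_one f_def[symmetric])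
          (simp_all add: f_def)
      moreover have "b \<in> matrices K B" unfolding b_def f_def by (intro E u e)
      ultimately show False using c unfolding spectrum_def by blast
    qed
    then show "c \<in> \<real>\<^sub>\<ge>\<^sub>0" by auto
  qed
qed

section \<open>From a proper isometry over the algebra to one over the subalgebra\<close>

lemma entry_sum_norm_minus_commute: "entry_sum_norm n (M - N) = entry_sum_norm n (N - M)"
  for M N :: "'a::real_normed_algebra fsmat"
  unfolding entry_sum_norm_def by (simp add: minus_fsmat.rep_eq norm_minus_commute)

lemma large_imp_not_finite:
  fixes B :: "'a::unital_cstar_algebra set" and L R :: "'a fsmat"
  assumes B: "unital_cstar_subalgebra UNIV 1 B"
    and large: "large (matrices K UNIV) (one_matrix K) (matrices K B)"
    and n: "1 \<le> n" "2 * n < K"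
    and LR: "L \<in> matrices K UNIV" "R \<in> matrices K UNIV" "L * R = one_matrix K" "one_matrix n * R = R"
  shows "\<not> finite_alg (matrices K B) (one_matrix K)"
proof
  assume fin: "finite_alg (matrices K B) (one_matrix K)"
  note E = matrices_ops[OF B, where n = K]
  note D = matrices_ops[OF unital_cstar_subalgebra_UNIV[where 'a = 'a], where n = K]
  let ?u = "one_matrix K :: 'a fsmat" and ?e = "one_matrix n :: 'a fsmat"
  have uE: "?u \<in> matrices K B" and eE: "?e \<in> matrices K B" using n by (auto intro!: E)
  have nz: "one_matrix k \<noteq> (0 :: 'a fsmat)" if "0 < k" for k
  proof -
    have "entry (one_matrix k) 0 0 = (1 :: 'a)" using that by (simp add: fsmat_entry)
    then show ?thesis by (metis zero_fsmat.rep_eq zero_neq_one)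
  qed
  have "?u \<noteq> 0" using n by (intro nz) simp
  then obtain t where t: "0 < t" "cstar_norm (complex_of_real t *\<^sub>C ?u) = 1"
    using cstar_norm_normalize[OF matrices_UNIV[OF uE]] by blast
  define C where "C = 4 * (real K)\<^sup>2"
  have C: "0 < C" using n by (simp add: C_def)
  have ent: "entry_sum_norm K M \<le> C * cstar_norm M" if "M \<in> matrices K UNIV" for M :: "'a fsmat"
    unfolding C_def by (rule entry_sum_norm_le_cstar_norm[OF that])
  define \<rho> where "\<rho> = entry_sum_norm K R"
  have \<rho>: "0 \<le> \<rho>" by (simp add: \<rho>_def entry_sum_norm_nonneg)
  \<comment> \<open>Chosen so that \<open>C * \<epsilon> * \<rho> < 1\<close>, which keeps
    \<open>(L - c) * R\<close> in the range of the Neumann series.\<close>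
  define \<epsilon> where "\<epsilon> = 1 / (C * (\<rho> + 1))"
  have \<epsilon>: "0 < \<epsilon>" using C \<rho> by (simp add: \<epsilon>_def)
  \<comment> \<open>Largeness is applied to the single element \<open>L\<close>, with
    \<open>?e\<close> as \<open>y\<close> and the normalized unit as \<open>x\<close>.\<close>
  note inst = large[unfolded large_def, THEN conjunct2, rule_format,
      of 1 "\<lambda>_. L" \<epsilon> "complex_of_real t *\<^sub>C ?u" ?e]
  obtain c g where c: "c \<in> matrices K UNIV" and g: "g \<in> matrices K B"
    and cL: "cstar_norm (c - L) < \<epsilon>" and gc: "(?u - g) * c \<in> matrices K B"
    and cuntz: "cuntz_below (matrices K B) g ?e"
  proof -
    have "1 \<le> (1 :: nat) \<and> (\<forall>j\<in>{1..1 :: nat}. L \<in> matrices K UNIV) \<and> 0 < \<epsilon> \<and>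
      positive (matrices K UNIV) ?u (complex_of_real t *\<^sub>C ?u) \<and> cstar_norm (complex_of_real t *\<^sub>C ?u) = 1 \<and>
      positive (matrices K B) ?u ?e \<and> ?e \<noteq> 0"
      using LR(1) \<epsilon> t positive_scaleC_one_matrix[OF t(1)] positive_one_matrix[OF B, of n K] n nz[of n]
      by simp
    from inst[OF this] show thesis using that by (auto simp: Ball_def)
  qed
  obtain v where v: "range v \<subseteq> matrices K B" "(\<lambda>i::nat. cstar_norm (v i * ?e * star (v i) - g)) \<longlonglongrightarrow> 0"
    using cuntz unfolding cuntz_below_def by blast
  \<comment> \<open>The threshold \<open>1 / C\<close> makes \<open>entry_sum_norm K M2\<close> less
    than 1 below.\<close>
  obtain i where i: "cstar_norm (v i * ?e * star (v i) - g) < 1 / C"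
    using order_tendstoD(2)[OF v(2), of "1 / C"] C eventually_happens' sequentially_bot by fastforce
  define v' where "v' = v i"
  have v': "v' \<in> matrices K B" using v(1) by (auto simp: v'_def)
  \<comment> \<open>\<open>c * R\<close> equals \<open>?u - M1\<close>, so \<open>R * X\<close> is a
    right inverse of \<open>c\<close> that still has its range in the corner of
    \<open>?e\<close>.\<close>
  define M1 where "M1 = (L - c) * R"
  have M1: "M1 \<in> matrices K UNIV" unfolding M1_def by (intro D LR c)
  have "entry_sum_norm K M1 \<le> entry_sum_norm K (L - c) * \<rho>"
    unfolding M1_def \<rho>_def by (rule entry_sum_norm_mult[OF D(2)[OF LR(1) c] LR(2)])
  also have "entry_sum_norm K (L - c) \<le> C * \<epsilon>"
    using ent[of "c - L"] D(2)[OF c LR(1)] cL C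
    unfolding entry_sum_norm_minus_commute[of K L c] by (smt (verit) mult_left_mono)
  also have "C * \<epsilon> * \<rho> < 1" using C \<rho> by (simp add: \<epsilon>_def)
  finally have "entry_sum_norm K M1 < 1" using \<rho> by (simp add: mult_right_mono)
  then obtain X where X: "X \<in> matrices K UNIV" "(?u - M1) * X = ?u"
    using matrix_right_inverse_near_one[OF M1] by blast
  define M2 where "M2 = g - v' * ?e * star v'"
  have M2: "M2 \<in> matrices K UNIV"
    unfolding M2_def by (rule matrices_UNIV[of _ _ B]) (intro E g v' eE)
  have "entry_sum_norm K M2 \<le> C * cstar_norm (v' * ?e * star v' - g)"
    unfolding M2_def entry_sum_norm_minus_commute[of K g]
    by (intro ent matrices_UNIV[of _ _ B] E g v' eE)
  also have "\<dots> < 1" using i C by (simp add: v'_def pos_less_divide_eq mult.commute)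
  finally obtain X2 where X2: "X2 \<in> matrices K UNIV" "(?u - M2) * X2 = ?u"
    using matrix_right_inverse_near_one[OF M2] by blast
  \<comment> \<open>A partial isometry from the indices \<open>n\<close> to \<open>2 * n - 1\<close>
    onto the first \<open>n\<close>. It gives the term with \<open>v'\<close> room of its own,
    orthogonal to the corner that carries \<open>R\<close>.\<close>
  define J :: "'a fsmat" where "J = truncated_matrix K (\<lambda>i j. if i < n \<and> j = i + n then 1 else 0)"
  have J: "J \<in> matrices K B"
    unfolding J_def using unital_cstar_subalgebra_ops(1,2)[OF B] by (intro truncated_matrix_matrices) auto
  have Jij: "entry J i j = (if i < n \<and> j = i + n then 1 else 0)" for i j
    using n by (auto simp: J_def truncated_matrix.rep_eq)
  have Je: "J * ?e = 0"
    by (rule fsmat_eqI) (simp add: entry_mult_one_matrix Jij fsmat_entry)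
  have eJ: "?e * star J = 0" using arg_cong[OF Je, of star] by (simp add: star_mult)
  have JJ: "J * star J = ?e"
  proof (rule fsmat_eqI)
    fix i j
    have "entry (J * star J) i j = (\<Sum>k<K. if k = i + n then (if i < n \<and> j = i then 1 else 0) else 0)"
      unfolding entry_mult_star[OF J] by (intro sum.cong refl) (auto simp: Jij)
    then show "entry (J * star J) i j = entry ?e i j" using n by (auto simp: fsmat_entry)
  qed
  \<comment> \<open>The index \<open>2 * n\<close> lies beyond both corners, so both summands of
    \<open>w\<close> kill it; \<open>2 * n < K\<close> provides this index.\<close>
  define f where "f = unit_matrix (2 * n) (2 * n) (1 :: 'a)"
  have f: "f \<in> matrices K UNIV" unfolding f_def using n by (intro unit_matrix_matrices) auto
  have ef: "?e * f = 0"
    by (rule fsmat_eqI) (simp add: entry_one_matrix_mult f_def unit_matrix.rep_eq fsmat_entry)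
  have Jf: "J * f = 0"
    by (rule fsmat_eqI) (simp add: f_def entry_mult_unit_matrix Jij fsmat_entry)
  have JR: "J * R = 0" using LR(4) Je by (metis mult.assoc mult_zero_left)
  define w where "w = (?u - g) * c * ?e + v' * J"
  have w: "w \<in> matrices K B" unfolding w_def by (intro E gc eE v' J)
  have wf: "w * f = 0" by (simp add: w_def distrib_right mult.assoc ef Jf)
  have "c * R = ?u - M1" using LR(3) by (simp add: M1_def algebra_simps)
  then have cRX: "c * (R * X) = ?u" using X(2) by (simp add: mult.assoc[symmetric])
  \<comment> \<open>The cross terms vanish by \<open>J * R = 0\<close> and
    \<open>?e * star J = 0\<close>. The others add up to \<open>?u - g\<close> plus the Cuntz
    approximation of \<open>g\<close>, that is, to \<open>?u - M2\<close>.\<close>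
  have "w * (R * X + star J * star v')
      = (?u - g) * (c * ((?e * R) * X)) + (?u - g) * c * ((?e * star J) * star v')
        + v' * ((J * R) * X) + v' * (J * star J) * star v'"
    by (simp only: w_def distrib_left distrib_right mult.assoc add.assoc add.left_commute)
  also have "\<dots> = (?u - g) * ?u + v' * ?e * star v'"
    by (simp add: LR(4) eJ JR JJ cRX)
  also have "\<dots> = ?u - M2"
    using one_matrix_mult[OF g order_refl] one_matrix_mult[OF uE order_refl]
    by (simp add: M2_def left_diff_distrib)
  finally have "w * ((R * X + star J * star v') * X2) = ?u" using X2(2) by (simp add: mult.assoc[symmetric])
  moreover have "(R * X + star J * star v') * X2 \<in> matrices K UNIV"
    by (intro D LR X X2 matrices_UNIV[OF J] matrices_UNIV[OF v'])
  ultimately obtain T where T: "T \<in> matrices K B" "T * w * star (T * w) = ?u"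
    using coisometry_of_right_invertible[OF B w] by metis
  have "star (T * w) \<in> matrices K B" by (intro E T w)
  then have iso: "star (T * w) * (T * w) = ?u"
    using fin T(2) unfolding finite_alg_def by (metis star_star)
  \<comment> \<open>Finiteness has made the coisometry \<open>T * w\<close> unitary, yet it
    annihilates \<open>f\<close>.\<close>
  have "f = ?u * f" by (rule one_matrix_mult(1)[OF f order_refl, symmetric])
  also have "\<dots> = star (T * w) * (T * (w * f))" unfolding iso[symmetric] by (simp only: mult.assoc)
  also have "\<dots> = 0" by (simp add: wf)
  finally have "entry f (2 * n) (2 * n) = 0" by (simp add: fsmat_entry)
  then show False by (simp add: f_def unit_matrix.rep_eq)
qed

theorem corollary6p16:
  fixes B :: "'a::unital_cstar_algebra set"
  assumes "infinite_dimensional (UNIV :: 'a set)"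
    and "simple (UNIV :: 'a set)"
    and "unital_cstar_subalgebra UNIV 1 B"
    and "stably_large UNIV B"
  shows "stably_finite (UNIV :: 'a set) \<longleftrightarrow> stably_finite B"
proof
  assume "stably_finite (UNIV :: 'a set)"
  \<comment> \<open>Matrices over \<open>B\<close> are matrices over the whole algebra with the same
    unit, so finiteness restricts.\<close>
  then show "stably_finite B"
    unfolding stably_finite_def finite_alg_def by (meson matrices_UNIV)
next
  assume fin: "stably_finite B"
  show "stably_finite (UNIV :: 'a set)"
    unfolding stably_finite_def finite_alg_def
  proof (intro allI impI ballI, rule ccontr)
    fix n :: nat and s :: "'a fsmat"
    assume s: "1 \<le> n" "s \<in> matrices n UNIV" "star s * s = one_matrix n" "s * star s \<noteq> one_matrix n"
    \<comment> \<open>Room for two corners of size \<open>n\<close> and one spare index.\<close>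
    define K where "K = 2 * n + 1"
    obtain L R :: "'a fsmat" where "L \<in> matrices K UNIV" "R \<in> matrices K UNIV" "L * R = one_matrix K"
      "one_matrix n * R = R"
      using unit_factors_through_corner[OF assms(2) s(2-4), of K] by (auto simp: K_def)
    moreover have "large (matrices K UNIV) (one_matrix K) (matrices K B)"
      using assms(4) by (simp add: stably_large_def K_def)
    ultimately have "\<not> finite_alg (matrices K B) (one_matrix K)"
      using large_imp_not_finite[OF assms(3), of K n L R] s(1) by (simp add: K_def)
    then show False using fin by (simp add: stably_finite_def K_def)
  qed
qed

end
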